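(* For every $n\ge4$, $\mathcal{PMV}(n,2)\subseteq \mathrm{Pl}_n$. Moreover, for every $n\ge 8$ this inclusion is proper.
   Context: $\mathcal K_2$ denotes the set of nonempty compact convex subsets of $\mathbb R^2$. The mixed area of $K,L\in\mathcal K_2$ is $\mathrm V(K,L)=\tfrac12\big(\mathrm{Vol}_2(K+L)-\mathrm{Vol}_2(K)-\mathrm{Vol}_2(L)\big)$. Coordinates of $\mathbb R^{\binom n2}$ are indexed by unordered pairs $\{i,j\}\subset[n]$, written $v_{ij}=v_{ji}$. $\mathcal{PMV}(n,2)=\{(\mathrm V(K_i,K_j))_{\{i,j\}\subset[n]} : K_1,\dots,K_n\in\mathcal K_2\}$. The Plücker space is $\mathrm{Pl}_n=\{v\in\mathbb R_{\ge0}^{\binom n2} : v_{ij}v_{kl}\le v_{ik}v_{jl}+v_{il}v_{jk}\ \text{for all } i,j,k,l\in[n] \text{ with } \{i,j\}\sqcup\{k,l\}\subseteq[n]\}$ (i.e. $i,j,k,l$ pairwise distinct). *)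

theory Defs
  imports "HOL-Analysis.Analysis"
begin

definition K2 :: "(real^2) set set" where
  "K2 = {K. K \<noteq> {} \<and> compact K \<and> convex K}"

definition minkowski_sum :: "(real^2) set \<Rightarrow> (real^2) set \<Rightarrow> (real^2) set" where
  "minkowski_sum K L = {x + y | x y. x \<in> K \<and> y \<in> L}"

definition area :: "(real^2) set \<Rightarrow> real" where
  "area K = measure lebesgue K"

definition mixed_area :: "(real^2) set \<Rightarrow> (real^2) set \<Rightarrow> real" where
  "mixed_area K L = (area (minkowski_sum K L) - area K - area L) / 2"

text \<open>Unordered pairs \<open>{i,j}\<close> of distinct elements of \<open>[n] = {1..n}\<close>; vectors in
  \<open>\<real>^(n choose 2)\<close> are functions on these pairs (taken to be 0 elsewhere).\<close>
definition pairs :: "nat \<Rightarrow> nat set set" where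
  "pairs n = {S. S \<subseteq> {1..n} \<and> card S = 2}"

definition PMV2 :: "nat \<Rightarrow> (nat set \<Rightarrow> real) set" where
  "PMV2 n = {v. \<exists>K :: nat \<Rightarrow> (real^2) set. (\<forall>i\<in>{1..n}. K i \<in> K2) \<and>
      v = (\<lambda>S. if S \<in> pairs n then mixed_area (K (Min S)) (K (Max S)) else 0)}"

definition Pl :: "nat \<Rightarrow> (nat set \<Rightarrow> real) set" where
  "Pl n = {v. (\<forall>S. S \<notin> pairs n \<longrightarrow> v S = 0) \<and> (\<forall>S\<in>pairs n. 0 \<le> v S) \<and>
      (\<forall>i\<in>{1..n}. \<forall>j\<in>{1..n}. \<forall>k\<in>{1..n}. \<forall>l\<in>{1..n}.
         distinct [i, j, k, l] \<longrightarrow>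
         v {i, j} * v {k, l} \<le> v {i, k} * v {j, l} + v {i, l} * v {j, k})}"

end

(*
  Cutting the corners of the bounding box of K successively along all integer directions removes
  triangles indexed by the Stern-Brocot tree, which gives the exact formula
    area K = w_1 w_2 - 1/2 * sum over (u,u') of (h(u) + h(u') - h(u+u'))^2,
  where h is the support function, w_1 and w_2 are the side lengths of the box, and (u,u') runs over the
  unimodular pairs of integer vectors in a common closed quadrant.  The right-hand side is a quadratic form
  in h of signature (+,-,-,...).  Hence the mixed area is bilinear and satisfies Minkowski's inequality
  V(K,L)^2 >= area(K) area(L).

  Pluecker inequality.  It suffices that V(K,L) M lies in a translate of V(L,M) K + V(K,M) L.  By Helly's
  theorem this only has to be tested on three half-planes at a time, that is, against a triangle.
  After an affine map the triangle is the standard one, and K and M may be assumed to touch all of its sides;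
  the translation vector is then found explicitly.

  Proper inclusion.  Take v_ij = 7/5 inside each of the blocks {1,..,4} and {5,..,8}, and 1 across.
  For K = K_1 + ... + K_4 and L = K_5 + ... + K_8, Minkowski's inequality would give (12 * 7/5)^2 <= 16^2.
*)

theory Submission
  imports Defs
begin

text \<open>Mixed areas are defined by areas of Minkowski sums, so not even additivity is available
  at the start. The exact formula supplies it: the defects and widths are additive in the body, so
  polarization gives a series that is linear in each argument. Unimodularity makes every cut-off
  triangle half the square of its defect, with no further weights.

  Passing to a containment loses nothing: its test against a triangle is the Pluecker inequality in
  which N is that triangle. So the inequality for four bodies rests on the case where one of them is
  a triangle, and there only contact points with its sides matter for K.

  The constant 7/5 lies between 4/3 and the square root of 2. With value t inside the blocks and 1
  across, the critical Pluecker inequality is t^2 <= 2, while two blocks of size m contradict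
  Minkowski's inequality once (m - 1) t > m. Size 3 would need t > 3/2, which is too large; size 4
  leaves a gap, whence two blocks of four.\<close>

abbreviation vec2 :: "real \<Rightarrow> real \<Rightarrow> real^2" where
  "vec2 a b \<equiv> vector [a, b]"

lemma inner_2: "x \<bullet> y = x$1 * y$1 + x$2 * y$2" for x y :: "real^2"
  by (simp add: inner_vec_def sum_2)

lemma vec2_eta: "vec2 (x$1) (x$2) = x" for x :: "real^2"
  by (simp add: vec_eq_iff forall_2)

section \<open>Support functions\<close>

definition supp :: "(real^2) set \<Rightarrow> real^2 \<Rightarrow> real" where
  "supp K u = (SUP x\<in>K. x \<bullet> u)"

lemma supp_attained:
  assumes "K \<in> K2"
  obtains x where "x \<in> K" "x \<bullet> u = supp K u"
proof -
  have "continuous_on K (\<lambda>x. x \<bullet> u)" by (intro continuous_intros)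
  then obtain x where x: "x \<in> K" "\<forall>y\<in>K. y \<bullet> u \<le> x \<bullet> u"
    using continuous_attains_sup[of K] assms by (auto simp: K2_def)
  then have "supp K u = x \<bullet> u" unfolding supp_def by (intro cSup_eq_maximum) auto
  with x that show ?thesis by auto
qed

lemma le_supp:
  assumes "K \<in> K2" "x \<in> K"
  shows "x \<bullet> u \<le> supp K u"
proof -
  have "compact ((\<lambda>x. x \<bullet> u) ` K)"
    using assms by (intro compact_continuous_image continuous_intros) (auto simp: K2_def)
  then have "bdd_above ((\<lambda>x. x \<bullet> u) ` K)"
    by (intro bounded_imp_bdd_above compact_imp_bounded)
  then show ?thesis unfolding supp_def using assms by (intro cSUP_upper)
qed

lemma supp_le_iff: "K \<in> K2 \<Longrightarrow> supp K u \<le> c \<longleftrightarrow> (\<forall>x\<in>K. x \<bullet> u \<le> c)"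
  by (metis le_supp order_trans supp_attained)

lemma supp_eqI:
  assumes "K \<in> K2" "x \<in> K" "x \<bullet> u = c" "\<And>y. y \<in> K \<Longrightarrow> y \<bullet> u \<le> c"
  shows "supp K u = c"
  using assms le_supp[OF assms(1,2), of u] supp_le_iff[OF assms(1), of u c] by force

lemma supp_0: "K \<in> K2 \<Longrightarrow> supp K 0 = 0"
  by (metis inner_zero_right supp_attained)

lemma supp_add: "K \<in> K2 \<Longrightarrow> supp K (u + v) \<le> supp K u + supp K v"
  by (auto simp: supp_le_iff inner_add_right intro: add_mono le_supp)

lemma supp_scale:
  assumes "K \<in> K2" "0 \<le> c"
  shows "supp K (c *\<^sub>R u) = c * supp K u"
proof -
  obtain x where "x \<in> K" "x \<bullet> u = supp K u" using assms supp_attained by blast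
  then show ?thesis using assms le_supp[OF assms(1)]
    by (intro supp_eqI[of K x]) (auto intro: mult_left_mono)
qed

lemma mem_if_supp:
  assumes K: "K \<in> K2" and le: "\<And>u. x \<bullet> u \<le> supp K u"
  shows "x \<in> K"
proof (rule ccontr)
  assume "x \<notin> K"
  moreover have "convex K" "closed K" using K by (auto simp: K2_def compact_imp_closed)
  ultimately obtain a b where ab: "a \<bullet> x < b" "\<forall>y\<in>K. a \<bullet> y > b"
    using separating_hyperplane_closed_point by blast
  have "supp K (-a) \<le> -b" using ab K by (auto simp: supp_le_iff inner_commute less_imp_le)
  with le[of "-a"] ab show False by (simp add: inner_commute)
qed

lemma subset_if_supp:
  assumes "K \<in> K2" "L \<in> K2" "\<And>u. supp K u \<le> supp L u"
  shows "K \<subseteq> L"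
  by (meson assms le_supp mem_if_supp order_trans subsetI)

lemma minkowski_sum_K2:
  assumes "K \<in> K2" "L \<in> K2"
  shows "minkowski_sum K L \<in> K2"
proof -
  have "minkowski_sum K L = (\<Union>x\<in>K. \<Union>y\<in>L. {x + y})" by (auto simp: minkowski_sum_def)
  with assms show ?thesis
    using convex_sums[of K L] compact_sums'[of K L] by (auto simp: K2_def)
qed

lemma supp_minkowski_sum:
  assumes K: "K \<in> K2" and L: "L \<in> K2"
  shows "supp (minkowski_sum K L) u = supp K u + supp L u"
proof -
  obtain x y where "x \<in> K" "x \<bullet> u = supp K u" "y \<in> L" "y \<bullet> u = supp L u"
    using assms supp_attained by metis
  then show ?thesis using assms
    by (intro supp_eqI[of _ "x + y"] minkowski_sum_K2)
      (auto simp: minkowski_sum_def inner_add_left intro!: add_mono le_supp)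
qed

lemma linear_image_K2: "K \<in> K2 \<Longrightarrow> linear g \<Longrightarrow> g ` K \<in> K2"
  by (auto simp: K2_def convex_linear_image linear_continuous_on linear_linear
      intro!: compact_continuous_image)

lemma supp_linear_image:
  assumes K: "K \<in> K2" and g: "linear g" and adj: "\<And>x. x \<in> K \<Longrightarrow> g x \<bullet> u = x \<bullet> v"
  shows "supp (g ` K) u = supp K v"
proof -
  obtain x where "x \<in> K" "x \<bullet> v = supp K v" using K supp_attained by blast
  then show ?thesis
    by (intro supp_eqI[of _ "g x"] linear_image_K2) (auto simp: K g adj le_supp)
qed

lemma scale_K2: "K \<in> K2 \<Longrightarrow> (*\<^sub>R) c ` K \<in> K2"
  by (intro linear_image_K2 linearI) (auto simp: algebra_simps)

lemma supp_scale_image: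
  assumes "K \<in> K2" "0 \<le> c"
  shows "supp ((*\<^sub>R) c ` K) u = c * supp K u"
  unfolding supp_scale[OF assms, symmetric]
  by (intro supp_linear_image linearI) (auto simp: assms algebra_simps)

lemma translate_K2: "K \<in> K2 \<Longrightarrow> (+) z ` K \<in> K2"
  by (auto simp: K2_def compact_translation)

lemma supp_translate:
  assumes K: "K \<in> K2"
  shows "supp ((+) z ` K) u = z \<bullet> u + supp K u"
proof -
  obtain x where "x \<in> K" "x \<bullet> u = supp K u" using K supp_attained by blast
  then show ?thesis
    by (intro supp_eqI[of _ "z + x"] translate_K2) (auto simp: K inner_add_left le_supp)
qed

lemma K2_lmeasurable: "K \<in> K2 \<Longrightarrow> K \<in> lmeasurable"
  by (simp add: K2_def lmeasurable_compact)

text \<open>Strict separation is homogeneous in the direction, so it survives rounding a large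
  multiple of a separating direction to an integer vector. This is why countably many cuts exhaust
  the complement of \<open>K\<close> in its box.\<close>

lemma integer_separation:
  assumes K: "K \<in> K2" and x: "x \<notin> K"
  obtains m n :: int where "supp K (vec2 m n) < x \<bullet> vec2 m n"
proof -
  obtain u where u: "supp K u < x \<bullet> u" using mem_if_supp[OF K, of x] x not_le by blast
  obtain R where R: "\<And>y. y \<in> K \<Longrightarrow> norm (y - x) \<le> R"
  proof -
    have "bounded K" using K by (simp add: K2_def compact_imp_bounded)
    then obtain B where "\<And>y. y \<in> K \<Longrightarrow> norm y \<le> B" by (auto simp: bounded_iff)
    then have "\<And>y. y \<in> K \<Longrightarrow> norm (y - x) \<le> B + norm x"
      by (meson add_right_mono norm_triangle_ineq4 order_trans)
    then show ?thesis using that by blast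
  qed
  then have "0 \<le> R" using K by (force simp: K2_def intro: order_trans[OF norm_ge_zero])
  \<comment> \<open>The separation gained by the factor \<open>N\<close> must beat
    \<open>R * 2\<close>, where 2 bounds the norm of the rounding error.\<close>
  obtain N :: nat where N: "real N * (x \<bullet> u - supp K u) > R * 2"
    using u reals_Archimedean3[of "x \<bullet> u - supp K u"] by auto
  define w :: "real^2" where "w = vec2 \<lfloor>N * u$1\<rfloor> \<lfloor>N * u$2\<rfloor>"
  define e where "e = w - N *\<^sub>R u"
  have "\<bar>e$1\<bar> \<le> 1" "\<bar>e$2\<bar> \<le> 1"
    unfolding e_def w_def by (auto simp: abs_le_iff) linarith+
  then have e: "norm e \<le> 2"
    using norm_le_l1_cart[of e] by (simp add: sum_2)
  have "supp K w < x \<bullet> w"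
  proof -
    obtain y where y: "y \<in> K" "y \<bullet> w = supp K w" using K supp_attained by blast
    have "(y - x) \<bullet> w = N * ((y - x) \<bullet> u) + (y - x) \<bullet> e"
      by (simp add: e_def inner_diff_right)
    moreover have "(y - x) \<bullet> e \<le> R * 2"
      using norm_cauchy_schwarz[of "y - x" e] mult_mono[OF R[OF y(1)] e \<open>0 \<le> R\<close>]
      by simp
    moreover have "N * ((y - x) \<bullet> u) \<le> N * (supp K u - x \<bullet> u)"
      using le_supp[OF K y(1), of u] by (intro mult_left_mono) (auto simp: inner_diff_left)
    ultimately have "(y - x) \<bullet> w < 0" using N by (simp add: algebra_simps)
    with y show ?thesis by (simp add: inner_diff_left)
  qed
  then show ?thesis using that w_def by blast
qed

section \<open>Area as a quadratic form in the support function\<close>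

text \<open>A point separated from \<open>K\<close> by the direction \<open>u + v\<close>, but not by \<open>u\<close> or \<open>v\<close>, is separated only
  by directions in the open cone spanned by \<open>u\<close> and \<open>v\<close>; this is why the cut-off corners are disjoint.\<close>
lemma cut_nonviolated:
  assumes K: "K \<in> K2"
    and u: "x \<bullet> u \<le> supp K u" and v: "x \<bullet> v \<le> supp K v"
    and uv: "supp K (u + v) < x \<bullet> (u + v)" and st: "\<not> (0 < s \<and> 0 < t)"
  shows "x \<bullet> (s *\<^sub>R u + t *\<^sub>R v) \<le> supp K (s *\<^sub>R u + t *\<^sub>R v)"
proof -
  have *: "x \<bullet> (s *\<^sub>R u + t *\<^sub>R v) \<le> supp K (s *\<^sub>R u + t *\<^sub>R v)"
    if u: "x \<bullet> u \<le> supp K u" and uv: "supp K (u + v) < x \<bullet> (u + v)" and "t \<le> 0" "t \<le> s" for u v s t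
  proof -
    \<comment> \<open>The coefficient of \<open>u + v\<close> is nonpositive, so the violated
      inequality enters with the favourable sign.\<close>
    have eq: "s *\<^sub>R u + t *\<^sub>R v = (s - t) *\<^sub>R u + t *\<^sub>R (u + v)"
      by (simp add: algebra_simps)
    have "(s - t) * supp K u = supp K ((s *\<^sub>R u + t *\<^sub>R v) + (- t) *\<^sub>R (u + v))"
      using supp_scale[OF K, of "s - t" u] that by (simp add: algebra_simps)
    also have "\<dots> \<le> supp K (s *\<^sub>R u + t *\<^sub>R v) + (- t) * supp K (u + v)"
      using supp_add[OF K, of "s *\<^sub>R u + t *\<^sub>R v" "(- t) *\<^sub>R (u + v)"]
        supp_scale[OF K, of "- t" "u + v"] that by simp
    finally have "(s - t) * supp K u + t * supp K (u + v) \<le> supp K (s *\<^sub>R u + t *\<^sub>R v)" by simp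
    moreover have "x \<bullet> (s *\<^sub>R u + t *\<^sub>R v) = (s - t) * (x \<bullet> u) + t * (x \<bullet> (u + v))"
      unfolding eq by (simp only: inner_add_right inner_scaleR_right)
    moreover have "(s - t) * (x \<bullet> u) \<le> (s - t) * supp K u" "t * (x \<bullet> (u + v)) \<le> t * supp K (u + v)"
      using that by (auto intro: mult_left_mono mult_left_mono_neg)
    ultimately show ?thesis by linarith
  qed
  have "t \<le> 0 \<and> t \<le> s \<or> s \<le> 0 \<and> s \<le> t" using st by linarith
  then show ?thesis
    using *[OF u uv, of t s] *[of v u s t] v uv by (auto simp: add.commute)
qed

section \<open>Corner triangles of unimodular pairs\<close>

lemma cut_triangle:
  fixes p q r :: real
  assumes det: "a * d - b * c = 1" and r: "r \<le> p + q"
  defines "S \<equiv> {x. x \<bullet> vec2 a b \<le> p \<and> x \<bullet> vec2 c d \<le> q \<and> r < x \<bullet> vec2 (a + c) (b + d)}"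
  shows "S \<in> lmeasurable" "measure lebesgue S = (p + q - r)\<^sup>2 / 2"
proof -
  \<comment> \<open>\<open>f\<close> inverts the area-preserving map sending \<open>x\<close> to its
    inner products with \<open>(a, b)\<close> and \<open>(c, d)\<close>. In these coordinates the
    corner is a right triangle with both legs \<open>p + q - r\<close>.\<close>
  define f where "f s t = vec2 (s * d - t * b) (t * a - s * c)" for s t
  have f1: "f s t \<bullet> vec2 a b = s" for s t
  proof -
    have "f s t \<bullet> vec2 a b = s * (a * d - b * c)" by (simp add: f_def inner_2 algebra_simps)
    then show ?thesis by (simp add: det)
  qed
  have f2: "f s t \<bullet> vec2 c d = t" for s t
  proof -
    have "f s t \<bullet> vec2 c d = t * (a * d - b * c)" by (simp add: f_def inner_2 algebra_simps)
    then show ?thesis by (simp add: det)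
  qed
  have split: "x \<bullet> vec2 (a + c) (b + d) = x \<bullet> vec2 a b + x \<bullet> vec2 c d" for x :: "real^2"
    by (simp add: inner_2 algebra_simps)
  have inv: "f (x \<bullet> vec2 a b) (x \<bullet> vec2 c d) = x" for x :: "real^2"
  proof -
    have "f (x \<bullet> vec2 a b) (x \<bullet> vec2 c d) = vec2 (x$1 * (a * d - b * c)) (x$2 * (a * d - b * c))"
      by (simp add: f_def inner_2 algebra_simps)
    then show ?thesis by (simp add: det vec2_eta)
  qed
  define T where "T = convex hull {f p q, f (r - q) q, f p (r - p)}"
  define S' where "S' = {x. x \<bullet> vec2 a b \<le> p \<and> x \<bullet> vec2 c d \<le> q \<and> r \<le> x \<bullet> vec2 (a + c) (b + d)}"
  have lin: "i *\<^sub>R f s t + j *\<^sub>R f s1 t1 + k *\<^sub>R f s2 t2 = f (i * s + j * s1 + k * s2) (i * t + j * t1 + k * t2)"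
    for i j k s t s1 t1 s2 t2
    by (simp add: f_def vec_eq_iff forall_2 algebra_simps)
  have "T = S'"
  proof
    show "T \<subseteq> S'"
      unfolding T_def
    proof (rule hull_minimal)
      show "{f p q, f (r - q) q, f p (r - p)} \<subseteq> S'"
        using r by (auto simp: S'_def split f1 f2)
      have "S' = {x. vec2 a b \<bullet> x \<le> p} \<inter> {x. vec2 c d \<bullet> x \<le> q} \<inter> {x. r \<le> vec2 (a + c) (b + d) \<bullet> x}"
        by (auto simp: S'_def inner_commute)
      then show "convex S'"
        using convex_halfspace_ge[of r "vec2 (a + c) (b + d)"]
        by (auto intro!: convex_Int convex_halfspace_le)
    qed
    show "S' \<subseteq> T"
    proof
      fix x assume x: "x \<in> S'"
      define s where "s = p - x \<bullet> vec2 a b"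
      define t where "t = q - x \<bullet> vec2 c d"
      have st: "0 \<le> s" "0 \<le> t" "s + t \<le> p + q - r"
        using x by (auto simp: s_def t_def S'_def split)
      have x_eq: "x = f (p - s) (q - t)" using inv[of x] by (simp add: s_def t_def)
      show "x \<in> T"
      proof (cases "p + q = r")
        case True
        then have "s = 0" "t = 0" using st by auto
        then show ?thesis using x_eq by (auto simp: T_def hull_inc)
      next
        case False
        define e where "e = p + q - r"
        have e: "e > 0" using False r by (simp add: e_def)
        have "x = (1 - (s + t) / e) *\<^sub>R f p q + (s / e) *\<^sub>R f (r - q) q + (t / e) *\<^sub>R f p (r - p)"
        proof -
          have 1: "r - q = p - e" "r - p = q - e" by (auto simp: e_def)
          show ?thesis unfolding lin x_eq 1 using e
            by (intro arg_cong2[of _ _ _ _ f]) (auto simp: field_simps)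
        qed
        moreover have "0 \<le> 1 - (s + t) / e" "0 \<le> s / e" "0 \<le> t / e" "1 - (s + t) / e + s / e + t / e = 1"
          using st(1,2) e st(3)[folded e_def] by (auto simp: field_simps)
        ultimately show ?thesis unfolding T_def convex_hull_3 by blast
      qed
    qed
  qed
  have meas: "measure lebesgue T = (p + q - r)\<^sup>2 / 2"
  proof -
    have "(f p (r - p) $ 1 - f p q $ 1) * (f (r - q) q $ 2 - f p q $ 2) -
        (f (r - q) q $ 1 - f p q $ 1) * (f p (r - p) $ 2 - f p q $ 2)
        = (p + q - r)\<^sup>2 * - (a * d - b * c)"
      by (simp add: f_def power2_eq_square algebra_simps)
    also have "\<dots> = - (p + q - r)\<^sup>2" by (simp add: det)
    finally have "measure lborel T = (p + q - r)\<^sup>2 / 2"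
      unfolding T_def content_triangle by simp
    moreover have "T \<in> sets borel" unfolding T_def
      by (intro borel_compact finite_imp_compact_convex_hull) auto
    ultimately show ?thesis by simp
  qed
  have T: "T \<in> lmeasurable" unfolding T_def
    by (intro lmeasurable_compact finite_imp_compact_convex_hull) auto
  \<comment> \<open>The strict inequality keeps corners disjoint from the body. It costs only a
    subset of a line.\<close>
  have "vec2 (a + c) (b + d) \<noteq> 0"
  proof
    assume "vec2 (a + c) (b + d) = 0"
    then have "a = - c" "b = - d" by (auto simp: vec_eq_iff forall_2)
    with det show False by simp
  qed
  then have "negligible {x. vec2 (a + c) (b + d) \<bullet> x = r}" by (intro negligible_hyperplane) auto
  moreover have "S' - S \<union> (S - S') \<subseteq> {x. vec2 (a + c) (b + d) \<bullet> x = r}"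
    by (auto simp: S_def S'_def inner_commute)
  ultimately have neg: "negligible (S' - S \<union> (S - S'))" by (rule negligible_subset)
  with T meas show "S \<in> lmeasurable" "measure lebesgue S = (p + q - r)\<^sup>2 / 2"
    unfolding \<open>T = S'\<close>
    by (metis lmeasurable_negligible_symdiff Un_commute, metis measure_negligible_symdiff fmeasurableD)
qed

text \<open>Quadruples \<open>(a, b, c, d)\<close> encode the pairs of vectors \<open>(a, b)\<close>, \<open>(c, d)\<close>; the sign conditions say that
  the two vectors lie in a common closed quadrant.\<close>
definition farey :: "(int \<times> int \<times> int \<times> int) set" where
  "farey = {(a, b, c, d). a * d - b * c = 1 \<and> 0 \<le> a * c \<and> 0 \<le> b * d}"

fun cut :: "(real^2) set \<Rightarrow> int \<times> int \<times> int \<times> int \<Rightarrow> (real^2) set" where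
  "cut K (a, b, c, d) = {x. x \<bullet> vec2 a b \<le> supp K (vec2 a b) \<and> x \<bullet> vec2 c d \<le> supp K (vec2 c d)
     \<and> supp K (vec2 (a + c) (b + d)) < x \<bullet> vec2 (a + c) (b + d)}"

fun defect :: "(real^2) set \<Rightarrow> int \<times> int \<times> int \<times> int \<Rightarrow> real" where
  "defect K (a, b, c, d) = supp K (vec2 a b) + supp K (vec2 c d) - supp K (vec2 (a + c) (b + d))"

lemma vec2_add: "vec2 a b + vec2 c d = vec2 (a + c) (b + d)"
  by (simp add: vec_eq_iff forall_2)

lemma vec2_scale: "s *\<^sub>R vec2 a b = vec2 (s * a) (s * b)"
  by (simp add: vec_eq_iff forall_2)

lemma cut_measure:
  assumes K: "K \<in> K2" and i: "i \<in> farey"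
  shows "cut K i \<in> lmeasurable" "measure lebesgue (cut K i) = (defect K i)\<^sup>2 / 2"
proof -
  obtain a b c d where i_eq: "i = (a, b, c, d)" by (cases i)
  have "real_of_int a * real_of_int d - real_of_int b * real_of_int c = 1"
    using i unfolding i_eq farey_def by (auto simp flip: of_int_mult of_int_diff)
  moreover have "supp K (vec2 (a + c) (b + d)) \<le> supp K (vec2 a b) + supp K (vec2 c d)"
    using supp_add[OF K, of "vec2 a b" "vec2 c d"] by (simp add: vec2_add)
  ultimately show "cut K i \<in> lmeasurable" "measure lebesgue (cut K i) = (defect K i)\<^sup>2 / 2"
    unfolding i_eq cut.simps defect.simps of_int_add by (rule cut_triangle)+
qed

lemma farey_coords:
  assumes "(a, b, c, d) \<in> farey"
  shows "vec2 m n = (m * d - n * c) *\<^sub>R vec2 a b + (a * n - b * m) *\<^sub>R vec2 c d"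
proof -
  have 1: "real_of_int a * real_of_int d - real_of_int b * real_of_int c = 1"
    using assms unfolding farey_def by (auto simp flip: of_int_mult of_int_diff)
  have "(m * d - n * c) * a + (a * n - b * m) * c
      = m * (real_of_int a * real_of_int d - real_of_int b * real_of_int c)"
    "(m * d - n * c) * b + (a * n - b * m) * d
      = n * (real_of_int a * real_of_int d - real_of_int b * real_of_int c)"
    by (auto simp: algebra_simps)
  then show ?thesis unfolding vec2_scale vec2_add 1 by simp
qed

lemma cut_violated_imp_pos:
  assumes K: "K \<in> K2" and i: "(a, b, c, d) \<in> farey" and x: "x \<in> cut K (a, b, c, d)"
    and viol: "supp K (vec2 m n) < x \<bullet> vec2 m n"
  shows "0 < m * d - n * c" "0 < a * n - b * m"
proof -
  have "0 < m * d - n * c \<and> 0 < a * n - b * m"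
  proof (rule ccontr)
    assume "\<not> ?thesis"
    from cut_nonviolated[OF K _ _ _ this, of x "vec2 a b" "vec2 c d"] x viol
    show False unfolding farey_coords[OF i, of m n, symmetric] by (auto simp: vec2_add)
  qed
  then show "0 < m * d - n * c" "0 < a * n - b * m" by auto
qed

text \<open>\<open>\<alpha>, \<beta>, \<gamma>, \<delta>\<close> are the coordinates of one unimodular pair with respect to another, when the sum of either
  pair lies in the open cone of the other one. The last two cases are impossible inside a quadrant.\<close>
lemma unimodular_cases:
  fixes \<alpha> \<beta> \<gamma> \<delta> :: int
  assumes det: "\<alpha> * \<delta> - \<beta> * \<gamma> = 1"
    and "1 \<le> \<alpha> + \<gamma>" "1 \<le> \<beta> + \<delta>" "\<gamma> < \<delta>" "\<beta> < \<alpha>"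
  shows "\<alpha> = 1 \<and> \<beta> = 0 \<and> \<gamma> = 0 \<and> \<delta> = 1 \<or> \<alpha> \<le> 0 \<and> \<beta> < 0 \<or> \<gamma> < 0 \<and> \<delta> \<le> 0"
proof -
  consider "0 \<le> \<beta>" "0 \<le> \<gamma>" | "\<beta> < 0" "\<gamma> < 0" | "\<beta> < 0" "0 \<le> \<gamma>" | "0 \<le> \<beta>" "\<gamma> < 0" by linarith
  then show ?thesis
  proof cases
    case 1
    have "(\<beta> + 1) * (\<gamma> + 1) \<le> \<alpha> * \<delta>" using 1 assms by (intro mult_mono) auto
    with 1 det have "\<beta> = 0" "\<gamma> = 0" by (auto simp: algebra_simps)
    with det assms show ?thesis by (auto simp: zmult_eq_1_iff)
  next
    case 2
    have "(1 - \<gamma>) * (1 - \<beta>) \<le> \<alpha> * \<delta>" using 2 assms by (intro mult_mono) auto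
    with 2 det show ?thesis by (auto simp: algebra_simps)
  next
    case 3
    then have "2 \<le> \<delta>" using assms by linarith
    have "\<beta> * \<gamma> \<le> 0" using 3 by (intro mult_nonpos_nonneg) auto
    then have "\<alpha> * \<delta> \<le> 1" using det by linarith
    have "\<alpha> \<le> 0"
    proof (rule ccontr)
      assume "\<not> \<alpha> \<le> 0"
      then have "1 * 2 \<le> \<alpha> * \<delta>" using \<open>2 \<le> \<delta>\<close> by (intro mult_mono) auto
      with \<open>\<alpha> * \<delta> \<le> 1\<close> show False by simp
    qed
    with 3 show ?thesis by auto
  next
    case 4
    then have "2 \<le> \<alpha>" using assms by linarith
    have "\<beta> * \<gamma> \<le> 0" using 4 by (intro mult_nonneg_nonpos) auto
    then have "\<alpha> * \<delta> \<le> 1" using det by linarith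
    have "\<delta> \<le> 0"
    proof (rule ccontr)
      assume "\<not> \<delta> \<le> 0"
      then have "2 * 1 \<le> \<alpha> * \<delta>" using \<open>2 \<le> \<alpha>\<close> by (intro mult_mono) auto
      with \<open>\<alpha> * \<delta> \<le> 1\<close> show False by simp
    qed
    with 4 show ?thesis by auto
  qed
qed

text \<open>As \<open>x\<close> and \<open>y\<close> have weakly equal signs, the two combinations
  have weakly opposite ones, and strictly so unless \<open>y = 0\<close>. Applied to each
  coordinate, this excludes pairs with one vector in a cone and the other in the opposite
  cone.\<close>

lemma same_sign_product:
  fixes x y :: int
  assumes xy: "0 \<le> x * y" and neg: "0 \<le> (- \<sigma> * x - \<tau> * y) * (s * x + t * y)"
    and "0 \<le> \<sigma>" "0 < \<tau>" "0 < s" "0 < t"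
  shows "y = 0"
proof (rule ccontr)
  assume "y \<noteq> 0"
  have "(- \<sigma> * x - \<tau> * y) * (s * x + t * y)
      = - ((\<sigma> * s) * (x * x) + (\<sigma> * t + \<tau> * s) * (x * y) + (\<tau> * t) * (y * y))"
    by (simp add: algebra_simps)
  moreover have "0 \<le> (\<sigma> * s) * (x * x)" "0 \<le> (\<sigma> * t + \<tau> * s) * (x * y)"
    using assms by (simp_all add: mult_nonneg_nonneg)
  moreover have "0 < y * y" using \<open>y \<noteq> 0\<close> by (auto simp: zero_less_mult_iff)
  then have "0 < (\<tau> * t) * (y * y)" using assms by simp
  ultimately show False using neg by linarith
qed

text \<open>The positivity conditions say that the sum of either pair lies in the open cone of the
  other pair. The matrix expressing one pair in the other has determinant 1, and the quadrant
  conditions leave only the identity.\<close>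

lemma farey_eqI:
  assumes i: "(a, b, c, d) \<in> farey" and j: "(a', b', c', d') \<in> farey"
    and pos: "0 < (a + c) * d' - (b + d) * c'" "0 < a' * (b + d) - b' * (a + c)"
      "0 < (a' + c') * d - (b' + d') * c" "0 < a * (b' + d') - b * (a' + c')"
  shows "(a, b, c, d) = (a', b', c', d')"
proof -
  define \<alpha> where "\<alpha> = a * d' - b * c'"
  define \<beta> where "\<beta> = a' * b - b' * a"
  define \<gamma> where "\<gamma> = c * d' - d * c'"
  define \<delta> where "\<delta> = a' * d - b' * c"
  note defs = \<alpha>_def \<beta>_def \<gamma>_def \<delta>_def
  have det: "a * d - b * c = 1" "a' * d' - b' * c' = 1"
    and sgn: "0 \<le> a * c" "0 \<le> b * d" "0 \<le> a' * c'" "0 \<le> b' * d'"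
    using i j by (auto simp: farey_def)
  have "\<alpha> * a' + \<beta> * c' = a * (a' * d' - b' * c')" "\<alpha> * b' + \<beta> * d' = b * (a' * d' - b' * c')"
    "\<gamma> * a' + \<delta> * c' = c * (a' * d' - b' * c')" "\<gamma> * b' + \<delta> * d' = d * (a' * d' - b' * c')"
    by (simp_all add: defs algebra_simps)
  then have eqs: "a = \<alpha> * a' + \<beta> * c'" "b = \<alpha> * b' + \<beta> * d'"
    "c = \<gamma> * a' + \<delta> * c'" "d = \<gamma> * b' + \<delta> * d'"
    by (auto simp: det)
  have "\<alpha> * \<delta> - \<beta> * \<gamma> = (a * d - b * c) * (a' * d' - b' * c')"
    by (simp add: defs algebra_simps)
  then have "\<alpha> * \<delta> - \<beta> * \<gamma> = 1" by (simp add: det)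
  moreover have "1 \<le> \<alpha> + \<gamma>" "1 \<le> \<beta> + \<delta>" "\<gamma> < \<delta>" "\<beta> < \<alpha>"
    using pos by (auto simp: defs algebra_simps)
  ultimately consider "\<alpha> = 1 \<and> \<beta> = 0 \<and> \<gamma> = 0 \<and> \<delta> = 1" | "\<alpha> \<le> 0" "\<beta> < 0" | "\<gamma> < 0" "\<delta> \<le> 0"
    using unimodular_cases by blast
  then show ?thesis
  proof cases
    case 1 then show ?thesis by (simp add: eqs)
  next
    case 2
    then have gd: "0 < \<gamma>" "0 < \<delta>" using \<open>1 \<le> \<alpha> + \<gamma>\<close> \<open>1 \<le> \<beta> + \<delta>\<close> by auto
    have "c' = 0" using 2 gd sgn same_sign_product[of a' c' "-\<alpha>" "-\<beta>" \<gamma> \<delta>] eqs by simp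
    moreover have "d' = 0" using 2 gd sgn same_sign_product[of b' d' "-\<alpha>" "-\<beta>" \<gamma> \<delta>] eqs by simp
    ultimately show ?thesis using det by simp
  next
    case 3
    then have ab: "0 < \<alpha>" "0 < \<beta>" using \<open>1 \<le> \<alpha> + \<gamma>\<close> \<open>1 \<le> \<beta> + \<delta>\<close> by auto
    have "a' = 0" using 3 ab sgn same_sign_product[of c' a' "-\<delta>" "-\<gamma>" \<beta> \<alpha>] eqs
      by (simp add: mult.commute add.commute)
    moreover have "b' = 0" using 3 ab sgn same_sign_product[of d' b' "-\<delta>" "-\<gamma>" \<beta> \<alpha>] eqs
      by (simp add: mult.commute add.commute)
    ultimately show ?thesis using det by simp
  qed
qed

text \<open>A common point violates the sum of either pair, which must then lie in the open cone of
  the other pair.\<close>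

lemma cut_disjoint:
  assumes K: "K \<in> K2" and "i \<in> farey" "j \<in> farey" "x \<in> cut K i" "x \<in> cut K j"
  shows "i = j"
proof -
  obtain a b c d a' b' c' d' where ij: "i = (a, b, c, d)" "j = (a', b', c', d')" by (metis prod_cases4)
  have viol: "supp K (vec2 (of_int (a + c)) (of_int (b + d))) < x \<bullet> vec2 (of_int (a + c)) (of_int (b + d))"
    "supp K (vec2 (of_int (a' + c')) (of_int (b' + d'))) < x \<bullet> vec2 (of_int (a' + c')) (of_int (b' + d'))"
    using assms unfolding ij by auto
  note pos = cut_violated_imp_pos[OF K assms(3)[unfolded ij] assms(5)[unfolded ij] viol(1)]
    cut_violated_imp_pos[OF K assms(2)[unfolded ij] assms(4)[unfolded ij] viol(2)]
  show ?thesis unfolding ij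
    by (rule farey_eqI) (use assms(2,3) pos in \<open>unfold ij of_int_mult[symmetric] of_int_diff[symmetric] of_int_0_less_iff, auto\<close>)
qed

text \<open>Descent in the Stern-Brocot tree: replacing one of the two vectors by their sum decreases \<open>s + t\<close>.\<close>
lemma cut_exists:
  fixes s t :: nat
  assumes K: "K \<in> K2" and "(a, b, c, d) \<in> farey"
    and "x \<bullet> vec2 a b \<le> supp K (vec2 a b)" "x \<bullet> vec2 c d \<le> supp K (vec2 c d)"
    and "supp K (s *\<^sub>R vec2 a b + t *\<^sub>R vec2 c d) < x \<bullet> (s *\<^sub>R vec2 a b + t *\<^sub>R vec2 c d)"
  shows "\<exists>i\<in>farey. x \<in> cut K i"
  using assms(2-)
proof (induction "s + t" arbitrary: s t a b c d rule: less_induct)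
  case less
  note i = less.prems(1) and u = less.prems(2) and v = less.prems(3) and viol = less.prems(4)
  have "s \<noteq> 0"
    by (rule notI) (use viol v supp_scale[OF K, of t "vec2 c d"] mult_left_mono[OF v, of t] in auto)
  moreover have "t \<noteq> 0"
    by (rule notI) (use viol u supp_scale[OF K, of s "vec2 a b"] mult_left_mono[OF u, of s] in auto)
  ultimately have nz: "s \<noteq> 0" "t \<noteq> 0" by auto
  show ?case
  proof (cases "x \<in> cut K (a, b, c, d)")
    case True with i show ?thesis by blast
  next
    case False
    then have w: "x \<bullet> vec2 (of_int (a + c)) (of_int (b + d)) \<le> supp K (vec2 (of_int (a + c)) (of_int (b + d)))"
      using u v by auto
    show ?thesis
    proof (cases "t \<le> s")
      case True
      have "s *\<^sub>R vec2 a b + t *\<^sub>R vec2 c d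
          = (s - t) *\<^sub>R vec2 a b + t *\<^sub>R vec2 (of_int (a + c)) (of_int (b + d))"
        using True by (simp add: vec2_scale vec2_add of_nat_diff algebra_simps)
      moreover have "(a, b, a + c, b + d) \<in> farey"
        using i by (auto simp: farey_def algebra_simps)
      ultimately show ?thesis
        using less.hyps[of "s - t" t a b "a + c" "b + d"] nz True u w viol by simp
    next
      case False
      have "s *\<^sub>R vec2 a b + t *\<^sub>R vec2 c d
          = s *\<^sub>R vec2 (of_int (a + c)) (of_int (b + d)) + (t - s) *\<^sub>R vec2 c d"
        using False by (simp add: vec2_scale vec2_add of_nat_diff algebra_simps)
      moreover have "(a + c, b + d, c, d) \<in> farey"
        using i by (auto simp: farey_def algebra_simps)
      ultimately show ?thesis
        using less.hyps[of s "t - s" "a + c" "b + d" c d] nz False v w viol by simp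
    qed
  qed
qed

section \<open>The bounding box and the exact area formula\<close>

definition bounding_box :: "(real^2) set \<Rightarrow> (real^2) set" where
  "bounding_box K = cbox (vec2 (- supp K (vec2 (-1) 0)) (- supp K (vec2 0 (-1))))
     (vec2 (supp K (vec2 1 0)) (supp K (vec2 0 1)))"

lemma mem_bounding_box:
  "x \<in> bounding_box K \<longleftrightarrow> x \<bullet> vec2 1 0 \<le> supp K (vec2 1 0) \<and> x \<bullet> vec2 0 1 \<le> supp K (vec2 0 1)
    \<and> x \<bullet> vec2 (-1) 0 \<le> supp K (vec2 (-1) 0) \<and> x \<bullet> vec2 0 (-1) \<le> supp K (vec2 0 (-1))"
  by (auto simp: bounding_box_def mem_box_cart forall_2 inner_2)

definition width :: "(real^2) set \<Rightarrow> real^2 \<Rightarrow> real" where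
  "width K u = supp K u + supp K (- u)"

lemma bounding_box_measure:
  assumes K: "K \<in> K2"
  shows "measure lebesgue (bounding_box K) = width K (vec2 1 0) * width K (vec2 0 1)"
proof -
  obtain x where "x \<in> K" using K by (auto simp: K2_def)
  then have "x \<in> bounding_box K" using K by (auto simp: mem_bounding_box le_supp)
  then have "bounding_box K \<noteq> {}" by auto
  moreover have "- vec2 1 0 = vec2 (-1) 0" "- vec2 0 1 = vec2 0 (-1)"
    by (auto simp: vec_eq_iff forall_2)
  ultimately show ?thesis
    unfolding bounding_box_def by (simp add: content_cbox_cart UNIV_2 width_def)
qed

lemma bounding_box_minus_eq:
  assumes K: "K \<in> K2"
  shows "bounding_box K - K = (\<Union>i\<in>farey. cut K i)"
proof (intro equalityI subsetI)
  fix x assume x: "x \<in> bounding_box K - K"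
  then obtain m n :: int where mn: "supp K (vec2 m n) < x \<bullet> vec2 m n"
    using integer_separation[OF K] by blast
  have *: "\<exists>i\<in>farey. x \<in> cut K i" if "(a, b, c, d) \<in> farey" "0 \<le> m * d - n * c" "0 \<le> a * n - b * m"
    "x \<bullet> vec2 a b \<le> supp K (vec2 a b)" "x \<bullet> vec2 c d \<le> supp K (vec2 c d)" for a b c d
  proof (rule cut_exists[OF K that(1,4,5)])
    have "vec2 m n = nat (m * d - n * c) *\<^sub>R vec2 a b + nat (a * n - b * m) *\<^sub>R vec2 c d"
      using farey_coords[OF that(1), of m n] that(2,3) by simp
    then show "supp K (nat (m * d - n * c) *\<^sub>R vec2 a b + nat (a * n - b * m) *\<^sub>R vec2 c d)
        < x \<bullet> (nat (m * d - n * c) *\<^sub>R vec2 a b + nat (a * n - b * m) *\<^sub>R vec2 c d)"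
      using mn by simp
  qed
  \<comment> \<open>The quadrant of the integer direction selects the pair of unit vectors at which
    the descent starts; the box guarantees that neither is violated.\<close>
  have mem: "(1, 0, 0, 1) \<in> farey" "(0, 1, -1, 0) \<in> farey" "(-1, 0, 0, -1) \<in> farey" "(0, -1, 1, 0) \<in> farey"
    by (auto simp: farey_def)
  consider "0 \<le> m" "0 \<le> n" | "m \<le> 0" "0 \<le> n" | "m \<le> 0" "n \<le> 0" | "0 \<le> m" "n \<le> 0" by linarith
  then have "\<exists>i\<in>farey. x \<in> cut K i"
    by cases (rule *[OF mem(1)] *[OF mem(2)] *[OF mem(3)] *[OF mem(4)];
        use x in \<open>simp add: mem_bounding_box\<close>)+
  then show "x \<in> (\<Union>i\<in>farey. cut K i)" by auto
next
  fix x assume "x \<in> (\<Union>i\<in>farey. cut K i)"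
  then obtain a b c d where i: "(a, b, c, d) \<in> farey" and x: "x \<in> cut K (a, b, c, d)" by auto
  have sgn: "0 \<le> a * c" "0 \<le> b * d" using i by (auto simp: farey_def)
  have "x \<notin> K" using x le_supp[OF K] by (auto simp: not_less[symmetric])
  moreover have "x \<bullet> vec2 m n \<le> supp K (vec2 m n)"
    if "\<not> (0 < m * d - n * c \<and> 0 < a * n - b * m)" for m n :: real
    using cut_violated_imp_pos[OF K i x, of m n] that by force
  \<comment> \<open>The coordinates of \<open>(1, 0)\<close> are \<open>d\<close> and
    \<open>- b\<close>, which are not both positive because \<open>0 \<le> b * d\<close>; the other
    unit vectors are similar. So a corner violates no side of the box.\<close>
  from this[of 1 0] this[of 0 1] this[of "-1" 0] this[of 0 "-1"] sgn
  have "x \<in> bounding_box K"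
    unfolding mem_bounding_box
    by (auto simp: zero_le_mult_iff)
  ultimately show "x \<in> bounding_box K - K" by auto
qed

definition farey_defect :: "(real^2) set \<Rightarrow> nat \<Rightarrow> real" where
  "farey_defect K n = (if n \<in> to_nat ` farey then defect K (from_nat n) else 0)"

lemma area_sums:
  assumes K: "K \<in> K2"
  shows "(\<lambda>n. (farey_defect K n)\<^sup>2 / 2) sums (width K (vec2 1 0) * width K (vec2 0 1) - area K)"
proof -
  define A where "A n = (if n \<in> to_nat ` farey then cut K (from_nat n) else {})" for n
  have UN: "(\<Union>n. A n) = bounding_box K - K"
    unfolding bounding_box_minus_eq[OF K] by (force simp: A_def split: if_splits)
  have box: "bounding_box K \<in> lmeasurable" by (simp add: bounding_box_def)
  have A: "A n \<in> lmeasurable" "measure lebesgue (A n) = (farey_defect K n)\<^sup>2 / 2" for n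
    using cut_measure[OF K] by (auto simp: A_def farey_defect_def)
  have "disjoint_family A"
    unfolding disjoint_family_on_def
    using cut_disjoint[OF K] by (fastforce simp: A_def split: if_splits)
  moreover have "emeasure lebesgue (\<Union>n. A n) \<noteq> \<infinity>"
    unfolding UN using box K2_lmeasurable[OF K] by (metis fmeasurableD2 fmeasurable.Diff fmeasurableD infinity_ennreal_def)
  ultimately have "(\<lambda>n. measure lebesgue (A n)) sums measure lebesgue (bounding_box K - K)"
    using measure_UNION[of A lebesgue] A(1) unfolding UN by (auto dest: fmeasurableD)
  moreover have "K \<subseteq> bounding_box K" using K by (auto simp: mem_bounding_box le_supp)
  ultimately show ?thesis
    using bounding_box_measure[OF K] K2_lmeasurable[OF K] box
    by (simp add: A(2) area_def measurable_measure_Diff fmeasurableD)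
qed

section \<open>Mixed areas\<close>

lemma farey_defect_sum:
  assumes "K \<in> K2" "L \<in> K2"
  shows "farey_defect (minkowski_sum K L) n = farey_defect K n + farey_defect L n"
proof -
  have "defect (minkowski_sum K L) i = defect K i + defect L i" for i
    using assms by (cases i) (simp add: supp_minkowski_sum)
  then show ?thesis by (simp add: farey_defect_def)
qed

lemma farey_defect_scale:
  assumes "K \<in> K2" "0 \<le> c"
  shows "farey_defect ((*\<^sub>R) c ` K) n = c * farey_defect K n"
proof -
  have "defect ((*\<^sub>R) c ` K) i = c * defect K i" for i
    using assms by (cases i) (simp add: supp_scale_image algebra_simps)
  then show ?thesis by (simp add: farey_defect_def)
qed

lemma width_sum: "K \<in> K2 \<Longrightarrow> L \<in> K2 \<Longrightarrow> width (minkowski_sum K L) u = width K u + width L u"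
  by (simp add: width_def supp_minkowski_sum)

lemma width_scale: "K \<in> K2 \<Longrightarrow> 0 \<le> c \<Longrightarrow> width ((*\<^sub>R) c ` K) u = c * width K u"
  by (simp add: width_def supp_scale_image algebra_simps)

text \<open>Polarization of \<open>area_sums\<close>, as defects and widths are additive under
  Minkowski sums.\<close>

lemma mixed_area_sums:
  assumes K: "K \<in> K2" and L: "L \<in> K2"
  shows "(\<lambda>n. farey_defect K n * farey_defect L n) sums
    (width K (vec2 1 0) * width L (vec2 0 1) + width L (vec2 1 0) * width K (vec2 0 1)
      - 2 * mixed_area K L)"
proof -
  have eq: "(farey_defect (minkowski_sum K L) n)\<^sup>2 / 2 - (farey_defect K n)\<^sup>2 / 2 - (farey_defect L n)\<^sup>2 / 2
      = farey_defect K n * farey_defect L n" for n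
    using assms by (simp add: farey_defect_sum power2_eq_square field_simps)
  have "(\<lambda>n. farey_defect K n * farey_defect L n) sums
     ((width K (vec2 1 0) + width L (vec2 1 0)) * (width K (vec2 0 1) + width L (vec2 0 1))
       - area (minkowski_sum K L) - (width K (vec2 1 0) * width K (vec2 0 1) - area K)
       - (width L (vec2 1 0) * width L (vec2 0 1) - area L))"
    using sums_diff[OF sums_diff[OF area_sums[OF minkowski_sum_K2[OF K L]] area_sums[OF K]] area_sums[OF L]]
    unfolding eq by (simp only: width_sum K L)
  then show ?thesis
    by (rule back_subst[where P = "\<lambda>s. _ sums s"]) (simp add: mixed_area_def field_simps)
qed

lemma mixed_area_add:
  assumes K: "K \<in> K2" and L: "L \<in> K2" and M: "M \<in> K2"
  shows "mixed_area (minkowski_sum K L) M = mixed_area K M + mixed_area L M"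
  using sums_unique2[OF mixed_area_sums[OF minkowski_sum_K2[OF K L] M]
      sums_add[OF mixed_area_sums[OF K M] mixed_area_sums[OF L M], folded distrib_right,
        folded farey_defect_sum[OF K L]]]
  by (simp add: width_sum K L algebra_simps)

lemma mixed_area_scale:
  assumes K: "K \<in> K2" and M: "M \<in> K2" and c: "0 \<le> c"
  shows "mixed_area ((*\<^sub>R) c ` K) M = c * mixed_area K M"
  using sums_unique2[OF mixed_area_sums[OF scale_K2[OF K] M]
      sums_mult[OF mixed_area_sums[OF K M], of c, folded mult.assoc, folded farey_defect_scale[OF K c]]]
  by (simp add: width_scale K c algebra_simps)

lemma mixed_area_self:
  assumes K: "K \<in> K2"
  shows "mixed_area K K = area K"
proof -
  have "(\<lambda>n. farey_defect K n * farey_defect K n) sums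
      (2 * (width K (vec2 1 0) * width K (vec2 0 1) - area K))"
    using sums_mult[OF area_sums[OF K], of 2] by (simp add: power2_eq_square)
  from sums_unique2[OF mixed_area_sums[OF K K] this] show ?thesis by simp
qed

lemma mixed_area_commute: "mixed_area K L = mixed_area L K"
proof -
  have "minkowski_sum K L = minkowski_sum L K"
    by (auto simp: minkowski_sum_def) (metis add.commute)+
  then show ?thesis by (simp add: mixed_area_def)
qed

lemma area_nonneg: "0 \<le> area K"
  by (simp add: area_def)

lemma area_mono: "K \<in> K2 \<Longrightarrow> L \<in> K2 \<Longrightarrow> K \<subseteq> L \<Longrightarrow> area K \<le> area L"
  unfolding area_def by (intro measure_mono_fmeasurable) (auto simp: K2_lmeasurable fmeasurableD)

text \<open>The area of \<open>t K + M\<close> is a quadratic polynomial in \<open>t\<close> with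
  constant term \<open>area M\<close> and linear coefficient twice the mixed area.\<close>

lemma mixed_area_mono:
  assumes K: "K \<in> K2" and L: "L \<in> K2" and M: "M \<in> K2" and sub: "K \<subseteq> L"
  shows "mixed_area K M \<le> mixed_area L M"
proof (rule ccontr)
  assume "\<not> ?thesis"
  then have pos: "0 < mixed_area K M - mixed_area L M" by simp
  have *: "area (minkowski_sum ((*\<^sub>R) t ` K) M) = area M + 2 * t * mixed_area K M + t\<^sup>2 * area K"
    if "0 \<le> t" "K \<in> K2" for t K
  proof -
    have "area ((*\<^sub>R) t ` K) = t * (t * mixed_area K K)"
      using that by (simp flip: mixed_area_self add: scale_K2 mixed_area_scale mixed_area_commute[of K "(*\<^sub>R) t ` K"])
    then show ?thesis
      using mixed_area_scale[OF that(2) M that(1)] mixed_area_self[OF that(2)]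
      by (simp add: mixed_area_def power2_eq_square field_simps)
  qed
  \<comment> \<open>This makes \<open>t * area L\<close> at most the assumed gap, half of what the
    comparison requires; the \<open>+ 1\<close> keeps the denominator positive.\<close>
  define t where "t = (mixed_area K M - mixed_area L M) / (area L + 1)"
  have t: "0 < t" using pos area_nonneg[of L] by (simp add: t_def)
  \<comment> \<open>comparing the terms of first order in \<open>t\<close>\<close>
  have "minkowski_sum ((*\<^sub>R) t ` K) M \<subseteq> minkowski_sum ((*\<^sub>R) t ` L) M"
    using sub by (fastforce simp: minkowski_sum_def)
  then have "area (minkowski_sum ((*\<^sub>R) t ` K) M) \<le> area (minkowski_sum ((*\<^sub>R) t ` L) M)"
    by (intro area_mono minkowski_sum_K2 scale_K2 K L M)
  then have "t * (2 * (mixed_area K M - mixed_area L M) + t * area K) \<le> t * (t * area L)"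
    using t by (simp add: * K L power2_eq_square algebra_simps)
  then have "2 * (mixed_area K M - mixed_area L M) + t * area K \<le> t * area L"
    using t by simp
  moreover have "0 \<le> t * area K" using t area_nonneg by simp
  ultimately have "2 * (mixed_area K M - mixed_area L M) \<le> t * area L" by simp
  also have "t * area L \<le> mixed_area K M - mixed_area L M"
    using pos area_nonneg[of L] by (simp add: t_def field_simps)
  finally show False using pos by simp
qed

lemma singleton_K2: "{z} \<in> K2"
  by (simp add: K2_def)

lemma area_translate: "area ((+) z ` K) = area K"
  by (simp add: area_def measure_translation)

lemma minkowski_sum_singleton: "minkowski_sum {z} K = (+) z ` K"
  by (auto simp: minkowski_sum_def)

lemma mixed_area_singleton: "mixed_area {z} K = 0"
  by (simp add: mixed_area_def minkowski_sum_singleton area_translate) (simp add: area_def)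

lemma mixed_area_nonneg:
  assumes K: "K \<in> K2" and L: "L \<in> K2"
  shows "0 \<le> mixed_area K L"
proof -
  obtain z where "z \<in> K" using K by (auto simp: K2_def)
  then show ?thesis
    using mixed_area_mono[OF singleton_K2 K L, of z] by (simp add: mixed_area_singleton)
qed

lemma mixed_area_translate:
  assumes "K \<in> K2" "L \<in> K2"
  shows "mixed_area ((+) z ` K) L = mixed_area K L"
  using mixed_area_add[OF singleton_K2 assms, of z]
  by (simp add: minkowski_sum_singleton mixed_area_singleton)

theorem minkowski_inequality:
  assumes K: "K \<in> K2" and L: "L \<in> K2"
  shows "area K * area L \<le> (mixed_area K L)\<^sup>2"
proof (cases "width L (vec2 1 0) = 0")
  case True
  \<comment> \<open>With zero width only the negative squares of the formula remain, so the area
    vanishes.\<close>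
  have "area L = - (\<Sum>n. (farey_defect L n)\<^sup>2 / 2)"
    using sums_unique[OF area_sums[OF L]] True by simp
  moreover have "0 \<le> (\<Sum>n. (farey_defect L n)\<^sup>2 / 2)"
    using area_sums[OF L] by (intro suminf_nonneg) (auto simp: sums_iff)
  ultimately show ?thesis using area_nonneg[of L] by simp
next
  case False
  \<comment> \<open>For this \<open>t\<close> the positive term of the form vanishes on the formal difference \<open>K - t L\<close>.\<close>
  define t where "t = width K (vec2 1 0) / width L (vec2 1 0)"
  have t: "width K (vec2 1 0) = t * width L (vec2 1 0)" using False by (simp add: t_def)
  have "(\<lambda>n. (farey_defect K n)\<^sup>2 / 2 - t * (farey_defect K n * farey_defect L n)
        + t\<^sup>2 * ((farey_defect L n)\<^sup>2 / 2)) sums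
      (2 * t * mixed_area K L - area K - t\<^sup>2 * area L)" (is "?f sums ?s")
    using sums_add[OF sums_diff[OF area_sums[OF K] sums_mult[OF mixed_area_sums[OF K L], of t]]
        sums_mult[OF area_sums[OF L], of "t\<^sup>2"]]
    by (simp add: t power2_eq_square algebra_simps)
  moreover have "0 \<le> ?f n" for n
  proof -
    have "?f n = (farey_defect K n - t * farey_defect L n)\<^sup>2 / 2"
      by (simp add: power2_eq_square field_simps)
    then show ?thesis by (simp only:) simp
  qed
  ultimately have "0 \<le> ?s" using suminf_nonneg[of ?f] by (simp add: sums_iff)
  \<comment> \<open>Multiplying by \<open>area L\<close> allows completing the square without
    dividing, so \<open>area L = 0\<close> is covered.\<close>
  then have "0 \<le> area L * ?s" using area_nonneg by simp
  also have "\<dots> = (mixed_area K L)\<^sup>2 - (mixed_area K L - t * area L)\<^sup>2 - area K * area L"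
    by (simp add: power2_eq_square algebra_simps)
  also have "\<dots> \<le> (mixed_area K L)\<^sup>2 - area K * area L" by simp
  finally show ?thesis by simp
qed

section \<open>Triangles\<close>

lemma tri_K2: "convex hull {p, q, r} \<in> K2"
  by (auto simp: K2_def intro!: finite_imp_compact_convex_hull)

lemma supp_tri: "supp (convex hull {p, q, r}) u = max (p \<bullet> u) (max (q \<bullet> u) (r \<bullet> u))"
proof (rule antisym)
  have "convex hull {p, q, r} \<subseteq> {x. u \<bullet> x \<le> max (p \<bullet> u) (max (q \<bullet> u) (r \<bullet> u))}"
    by (intro hull_minimal convex_halfspace_le) (auto simp: inner_commute)
  then show "supp (convex hull {p, q, r}) u \<le> max (p \<bullet> u) (max (q \<bullet> u) (r \<bullet> u))"
    by (auto simp: supp_le_iff[OF tri_K2] inner_commute)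
  show "max (p \<bullet> u) (max (q \<bullet> u) (r \<bullet> u)) \<le> supp (convex hull {p, q, r}) u"
    by (auto intro!: le_supp[OF tri_K2] hull_inc)
qed

definition std_triangle :: "(real^2) set" where
  "std_triangle = convex hull {0, vec2 1 0, vec2 0 1}"

lemma std_triangle_K2: "std_triangle \<in> K2"
  by (simp add: std_triangle_def tri_K2)

lemma supp_std_triangle: "supp std_triangle u = max 0 (max (u$1) (u$2))"
  by (simp add: std_triangle_def supp_tri inner_2)

text \<open>The support function \<open>max 0 (max x y)\<close> of the standard triangle is linear on the cones spanned by all
  but one of the pairs.\<close>
lemma farey_linear:
  assumes "(a, b, c, d) \<in> farey" "(a, b, c, d) \<noteq> (1, 0, 0, 1)"
  shows "max 0 (max a b) + max 0 (max c d) = max 0 (max (a + c) (b + d))"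
proof -
  have det: "a * d - b * c = 1" and "0 \<le> a * c" "0 \<le> b * d" using assms by (auto simp: farey_def)
  then consider "0 \<le> a" "0 \<le> c" "0 \<le> b" "0 \<le> d" | "0 \<le> a" "0 \<le> c" "b \<le> 0" "d \<le> 0"
    | "a \<le> 0" "c \<le> 0" "0 \<le> b" "0 \<le> d" | "a \<le> 0" "c \<le> 0" "b \<le> 0" "d \<le> 0"
    by (auto simp: zero_le_mult_iff)
  then show ?thesis
  proof cases
    case 1
    have "b \<le> a \<and> d \<le> c \<or> a \<le> b \<and> c \<le> d"
    proof (rule ccontr)
      assume "\<not> ?thesis"
      then consider "b < a" "c < d" | "a < b" "d < c" by linarith
      then show False
      proof cases
        assume bc: "b < a" "c < d"
        then have "(b + 1) * (c + 1) \<le> a * d" using 1 by (intro mult_mono) auto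
        then have "b = 0" "c = 0" using det 1 by (auto simp: algebra_simps)
        with det assms 1 show False by (auto simp: zmult_eq_1_iff)
      next
        assume "a < b" "d < c"
        then have "a * d \<le> b * c" using 1 by (intro mult_mono) auto
        with det show False by simp
      qed
    qed
    with 1 show ?thesis by auto
  qed (simp_all add: max_def)
qed

text \<open>The bounding box is the unit square, and the triangle arises from it by cutting off the
  single corner at \<open>(1, 1)\<close>.\<close>

lemma defect_std_triangle:
  assumes "i \<in> farey"
  shows "defect std_triangle i = (if i = (1, 0, 0, 1) then 1 else 0)"
proof -
  obtain a b c d where i: "i = (a, b, c, d)" by (cases i)
  have eq: "defect std_triangle i
      = of_int (max 0 (max a b) + max 0 (max c d) - max 0 (max (a + c) (b + d)))"
    by (simp add: i supp_std_triangle of_int_max)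
  show ?thesis
  proof (cases "i = (1, 0, 0, 1)")
    case True
    then show ?thesis using eq by (simp add: i)
  next
    case False
    then have "max 0 (max a b) + max 0 (max c d) = max 0 (max (a + c) (b + d))"
      using assms unfolding i by (rule farey_linear[rotated])
    with False show ?thesis unfolding eq by (simp only: if_False diff_self of_int_0)
  qed
qed

text \<open>The series for the mixed area has a single nonzero term. The three directions are the
  outer normals scaled to the edge lengths.\<close>

lemma mixed_area_std_triangle:
  assumes M: "M \<in> K2"
  shows "2 * mixed_area std_triangle M = supp M (vec2 (-1) 0) + supp M (vec2 0 (-1)) + supp M (vec2 1 1)"
proof -
  define n where "n = to_nat (1::int, 0::int, 0::int, 1::int)"
  have n: "n \<in> to_nat ` farey" by (auto simp: n_def farey_def)
  have "farey_defect std_triangle k * farey_defect M k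
      = (if k = n then defect M (1, 0, 0, 1) else 0)" for k
    using n by (auto simp: farey_defect_def defect_std_triangle n_def simp del: defect.simps)
  then have "(\<lambda>k. farey_defect std_triangle k * farey_defect M k) sums defect M (1, 0, 0, 1)"
    using sums_single[of n "\<lambda>_. defect M (1, 0, 0, 1)"] by simp
  from sums_unique2[OF this mixed_area_sums[OF std_triangle_K2 M]]
  have "2 * mixed_area std_triangle M = width M (vec2 0 1) + width M (vec2 1 0) - defect M (1, 0, 0, 1)"
    by (simp add: width_def supp_std_triangle algebra_simps)
  moreover have "- vec2 1 0 = vec2 (-1) 0" "- vec2 0 1 = vec2 0 (-1)"
    by (auto simp: vec_eq_iff forall_2)
  ultimately show ?thesis by (simp add: width_def)
qed

section \<open>Transport to arbitrary triangles\<close>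

lemma area_linear_image:
  assumes "K \<in> K2" "linear g"
  shows "area (g ` K) = \<bar>det (matrix g)\<bar> * area K"
  using assms by (simp add: area_def measure_linear_image K2_lmeasurable)

lemma mixed_area_linear_image:
  assumes "K \<in> K2" "L \<in> K2" "linear g"
  shows "mixed_area (g ` K) (g ` L) = \<bar>det (matrix g)\<bar> * mixed_area K L"
proof -
  have "minkowski_sum (g ` K) (g ` L) = g ` minkowski_sum K L"
    by (force simp: minkowski_sum_def linear_add[OF assms(3)] image_iff)
  then show ?thesis
    by (simp add: mixed_area_def area_linear_image assms minkowski_sum_K2 algebra_simps)
qed

definition cross2 :: "real^2 \<Rightarrow> real^2 \<Rightarrow> real" where
  "cross2 x y = x$1 * y$2 - x$2 * y$1"

text \<open>A clockwise quarter turn: it sends the edges of a counterclockwise polygon to outer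
  normals of the same length.\<close>

definition rot :: "real^2 \<Rightarrow> real^2" where
  "rot x = vec2 (x$2) (- x$1)"

definition frame :: "real^2 \<Rightarrow> real^2 \<Rightarrow> real^2 \<Rightarrow> real^2" where
  "frame u v x = (x$1) *\<^sub>R u + (x$2) *\<^sub>R v"

lemma linear_frame: "linear (frame u v)"
  by (intro linearI) (auto simp: frame_def algebra_simps)

lemma det_frame: "det (matrix (frame u v)) = cross2 u v"
  by (simp add: det_2 matrix_def frame_def cross2_def axis_def)

definition coframe :: "real^2 \<Rightarrow> real^2 \<Rightarrow> real^2 \<Rightarrow> real^2" where
  "coframe u v x = vec2 (cross2 x v / cross2 u v) (cross2 u x / cross2 u v)"

lemma linear_coframe: "linear (coframe u v)"
  by (intro linearI) (auto simp: coframe_def cross2_def vec_eq_iff forall_2 algebra_simps simp flip: add_divide_distrib)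

lemma coframe_inner:
  assumes "cross2 u v \<noteq> 0"
  shows "cross2 u v * (coframe u v x \<bullet> w) = cross2 x v * w$1 + cross2 u x * w$2"
  using assms by (simp add: coframe_def inner_2 add_divide_distrib[symmetric])

lemma frame_coframe:
  assumes "cross2 u v \<noteq> 0"
  shows "frame u v (coframe u v x) = x"
proof -
  have "cross2 x v * u$1 + cross2 u x * v$1 = x$1 * cross2 u v"
    "cross2 x v * u$2 + cross2 u x * v$2 = x$2 * cross2 u v"
    by (auto simp: cross2_def algebra_simps)
  with assms show ?thesis
    by (simp add: frame_def coframe_def vec_eq_iff forall_2 add_divide_distrib[symmetric])
qed

lemma mixed_area_tri:
  assumes M: "M \<in> K2" and pos: "0 < cross2 (q - p) (r - p)"
  shows "2 * mixed_area (convex hull {p, q, r}) M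
    = supp M (rot (q - p)) + supp M (rot (r - q)) + supp M (rot (p - r))"
proof -
  define u v where uv: "u = q - p" "v = r - p"
  have pos: "0 < cross2 u v" using pos by (simp add: uv)
  define N where "N = coframe u v ` M"
  have N: "N \<in> K2" unfolding N_def by (intro linear_image_K2 M linear_coframe)
  have gN: "frame u v ` N = M" using pos by (force simp: N_def image_image frame_coframe)
  have eqs: "q = p + u" "r = p + v" by (auto simp: uv)
  have "convex hull {p, q, r} = (+) p ` frame u v ` std_triangle"
    unfolding std_triangle_def convex_hull_linear_image[OF linear_frame] convex_hull_translation[symmetric]
    by (simp add: eqs frame_def)
  then have "mixed_area (convex hull {p, q, r}) M = mixed_area (frame u v ` std_triangle) (frame u v ` N)"
    by (simp add: gN mixed_area_translate M linear_image_K2 linear_frame std_triangle_K2)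
  also have "\<dots> = cross2 u v * mixed_area std_triangle N"
    using pos by (simp add: mixed_area_linear_image linear_frame std_triangle_K2 N det_frame)
  finally have "2 * mixed_area (convex hull {p, q, r}) M = cross2 u v * (2 * mixed_area std_triangle N)" by simp
  moreover have "cross2 u v * supp N w = supp M w'"
    if "\<And>x. cross2 x v * w$1 + cross2 u x * w$2 = x \<bullet> w'" for w w'
  proof -
    have "supp N w = supp M ((1 / cross2 u v) *\<^sub>R w')"
      unfolding N_def using coframe_inner[of u v] that pos
      by (intro supp_linear_image M linear_coframe) (simp add: field_simps)
    then show ?thesis using pos M by (simp add: supp_scale)
  qed
  from this[of "vec2 (-1) 0" "rot (p - r)"] this[of "vec2 0 (-1)" "rot (q - p)"] this[of "vec2 1 1" "rot (r - q)"]
  have "cross2 u v * supp N (vec2 (-1) 0) = supp M (rot (p - r))"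
    "cross2 u v * supp N (vec2 0 (-1)) = supp M (rot (q - p))"
    "cross2 u v * supp N (vec2 1 1) = supp M (rot (r - q))"
    by (auto simp: inner_2 rot_def eqs cross2_def[of _ v] cross2_def[of u] algebra_simps)
  ultimately show ?thesis
    unfolding mixed_area_std_triangle[OF N] distrib_left by simp
qed

section \<open>The obstruction for two blocks\<close>

lemma two_blocks_not_realizable:
  assumes K: "\<And>i. i \<in> {1..8::nat} \<Longrightarrow> K i \<in> K2"
    and V: "\<And>i j. i \<in> {1..8} \<Longrightarrow> j \<in> {1..8} \<Longrightarrow> i \<noteq> j \<Longrightarrow>
      mixed_area (K i) (K j) = (if (i \<le> 4) = (j \<le> 4) then 7/5 else 1)"
  shows False
proof -
  have add_right: "mixed_area M (minkowski_sum K L) = mixed_area M K + mixed_area M L"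
    if "K \<in> K2" "L \<in> K2" "M \<in> K2" for K L M
    using mixed_area_add[OF that] by (simp add: mixed_area_commute)
  define A where "A = minkowski_sum (K 1) (minkowski_sum (K 2) (minkowski_sum (K 3) (K 4)))"
  define B where "B = minkowski_sum (K 5) (minkowski_sum (K 6) (minkowski_sum (K 7) (K 8)))"
  have AB: "A \<in> K2" "B \<in> K2" unfolding A_def B_def by (intro minkowski_sum_K2 K; simp)+
  have nonneg: "0 \<le> mixed_area (K i) (K i)" if "i \<in> {1..8}" for i
    using K[OF that] by (intro mixed_area_nonneg)
  note exp = A_def B_def mixed_area_add add_right minkowski_sum_K2 K V
  \<comment> \<open>The twelve ordered pairs of distinct bodies contribute \<open>12 * 7/5\<close>;
    the four areas are merely nonnegative.\<close>
  have "84/5 \<le> mixed_area A A"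
    using nonneg[of 1] nonneg[of 2] nonneg[of 3] nonneg[of 4] by (simp add: exp)
  moreover have "84/5 \<le> mixed_area B B"
    using nonneg[of 5] nonneg[of 6] nonneg[of 7] nonneg[of 8] by (simp add: exp)
  ultimately have "84/5 * (84/5) \<le> mixed_area A A * mixed_area B B"
    by (intro mult_mono) auto
  also have "\<dots> \<le> (mixed_area A B)\<^sup>2"
    using minkowski_inequality[OF AB] AB by (simp add: mixed_area_self)
  also have "mixed_area A B = 16" by (simp add: exp)
  finally show False by simp
qed

section \<open>Two bodies inscribed in a triangle\<close>

text \<open>Parametrize a triangle inscribed in the standard triangle \<open>ABC\<close> by \<open>r = A + c (B - A)\<close>,
  \<open>p = B + a (C - B)\<close>, \<open>q = C + b (A - C)\<close>. The three inequalities below say that a second inscribed body stays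
  behind the lines \<open>qr\<close>, \<open>rp\<close>, \<open>pq\<close> after the inscribed triangle is enlarged by \<open>X + Y + Z\<close> copies of \<open>ABC\<close> and
  translated accordingly. Here \<open>\<alpha>\<close>, \<open>\<beta>\<close>, \<open>\<gamma>\<close> measure how far that body reaches beyond the respective line towards
  \<open>A\<close>, \<open>B\<close>, \<open>C\<close>; the value 1 means that it contains the vertex, a negative value that it does not reach the line.
  The right-hand side of the last line is twice the mixed area of the inscribed triangle and that body.\<close>
definition corner_shift :: "real \<Rightarrow> real \<Rightarrow> real \<Rightarrow> real \<Rightarrow> real \<Rightarrow> real \<Rightarrow> bool" where
  "corner_shift a b c \<alpha> \<beta> \<gamma> \<longleftrightarrow> (\<exists>X\<ge>0. \<exists>Y\<ge>0. \<exists>Z\<ge>0.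
     c * (1 - b) * \<alpha> \<le> (1 - b) * Y + c * Z \<and>
     a * (1 - c) * \<beta> \<le> (1 - c) * Z + a * X \<and>
     b * (1 - a) * \<gamma> \<le> (1 - a) * X + b * Y \<and>
     X + Y + Z \<le> a * b * c + (1 - a) * (1 - b) * (1 - c)
       + c * (1 - b) * \<alpha> + a * (1 - c) * \<beta> + b * (1 - a) * \<gamma>)"

lemma corner_shift_rotate: "corner_shift b c a \<beta> \<gamma> \<alpha> \<Longrightarrow> corner_shift a b c \<alpha> \<beta> \<gamma>"
proof -
  assume "corner_shift b c a \<beta> \<gamma> \<alpha>"
  then obtain Y Z X where "0 \<le> X" "0 \<le> Y" "0 \<le> Z" "a * (1 - c) * \<beta> \<le> (1 - c) * Z + a * X"
    "b * (1 - a) * \<gamma> \<le> (1 - a) * X + b * Y" "c * (1 - b) * \<alpha> \<le> (1 - b) * Y + c * Z"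
    "Y + Z + X \<le> b * c * a + (1 - b) * (1 - c) * (1 - a)
       + a * (1 - c) * \<beta> + b * (1 - a) * \<gamma> + c * (1 - b) * \<alpha>"
    unfolding corner_shift_def by blast
  then show ?thesis unfolding corner_shift_def
    by (intro exI[of _ X] exI[of _ Y] exI[of _ Z] conjI) (simp_all add: algebra_simps)
qed

text \<open>Exchanging \<open>B\<close> and \<open>C\<close> reverses the orientation:
  \<open>a\<close> becomes \<open>1 - a\<close>, and the points on the other two sides trade
  places.\<close>

lemma corner_shift_reflect:
  "corner_shift (1 - a) (1 - c) (1 - b) \<alpha> \<gamma> \<beta> \<Longrightarrow> corner_shift a b c \<alpha> \<beta> \<gamma>"
proof -
  assume "corner_shift (1 - a) (1 - c) (1 - b) \<alpha> \<gamma> \<beta>"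
  then obtain X Z Y where *: "0 \<le> X" "0 \<le> Z" "0 \<le> Y"
    "(1 - b) * (1 - (1 - c)) * \<alpha> \<le> (1 - (1 - c)) * Z + (1 - b) * Y"
    "(1 - a) * (1 - (1 - b)) * \<gamma> \<le> (1 - (1 - b)) * Y + (1 - a) * X"
    "(1 - c) * (1 - (1 - a)) * \<beta> \<le> (1 - (1 - a)) * X + (1 - c) * Z"
    "X + Z + Y \<le> (1 - a) * (1 - c) * (1 - b) + (1 - (1 - a)) * (1 - (1 - c)) * (1 - (1 - b))
       + (1 - b) * (1 - (1 - c)) * \<alpha> + (1 - a) * (1 - (1 - b)) * \<gamma> + (1 - c) * (1 - (1 - a)) * \<beta>"
    unfolding corner_shift_def by blast
  then show ?thesis unfolding corner_shift_def
    by (intro exI[of _ X] exI[of _ Y] exI[of _ Z] conjI) (simp_all add: algebra_simps)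
qed

lemma corner_shift_nonneg:
  assumes abc: "0 < a" "a < 1" "0 < b" "b < 1" "0 < c" "c < 1"
    and ord: "0 \<le> \<alpha>" "\<alpha> \<le> \<beta>" "\<beta> \<le> \<gamma>" "\<gamma> \<le> 1"
  shows "corner_shift a b c \<alpha> \<beta> \<gamma>"
proof -
  \<comment> \<open>For the depths (0, 1, 1) the witness is \<open>X = \<mu>\<close> alone: the
    constraints at \<open>B\<close> and \<open>C\<close> then read \<open>1 - c \<le> X\<close> and
    \<open>b \<le> X\<close>.\<close>
  define \<mu> where "\<mu> = max b (1 - c)"
  \<comment> \<open>Twice the area of the inscribed triangle; \<open>\<Delta>_eq\<close> below
    obtains it by removing the three corners.\<close>
  define \<Delta> where "\<Delta> = a * b * c + (1 - a) * (1 - b) * (1 - c)"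
  have \<Delta>: "0 \<le> \<Delta>" using abc by (simp add: \<Delta>_def)
  have \<Delta>_eq: "\<Delta> = 1 - c * (1 - b) - a * (1 - c) - b * (1 - a)"
    by (simp add: \<Delta>_def algebra_simps)
  have \<mu>: "0 \<le> \<mu>" "b \<le> \<mu>" "1 - c \<le> \<mu>" using abc by (auto simp: \<mu>_def)
  have "b \<le> 1 - c * (1 - b)" "1 - c \<le> 1 - c * (1 - b)"
    using abc mult_right_mono[of c 1 "1 - b"] by (auto simp: algebra_simps)
  then have \<mu>_le: "\<mu> \<le> 1 - c * (1 - b)" by (simp add: \<mu>_def)
  \<comment> \<open>For the depths (0, 0, 1) only the constraint at \<open>C\<close> binds, and the
    cheaper of \<open>X\<close> and \<open>Y\<close> meets it at cost
    \<open>min b (1 - a)\<close>.\<close>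
  obtain \<xi> \<eta> where \<xi>: "0 \<le> \<xi>" "0 \<le> \<eta>" "(1 - a) * \<xi> + b * \<eta> = b * (1 - a)"
    "\<xi> + \<eta> \<le> 1 - c * (1 - b) - a * (1 - c)"
  proof (cases "b \<le> 1 - a")
    case True
    have "0 \<le> (1 - c) * (1 - a - b)" using True abc by simp
    then have "b \<le> 1 - c * (1 - b) - a * (1 - c)" by (simp add: algebra_simps)
    then show ?thesis using that[of b 0] abc by (simp add: algebra_simps)
  next
    case False
    have "0 \<le> c * (a + b - 1)" using False abc by simp
    then have "1 - a \<le> 1 - c * (1 - b) - a * (1 - c)" by (simp add: algebra_simps)
    then show ?thesis using that[of 0 "1 - a"] abc by simp
  qed
  \<comment> \<open>combines the solutions for the depths \<open>(1, 1, 1)\<close>, \<open>(0, 1, 1)\<close> and \<open>(0, 0, 1)\<close>\<close>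
  define X where "X = (\<beta> - \<alpha>) * \<mu> + (\<gamma> - \<beta>) * \<xi>"
  define Y where "Y = \<alpha> * (1 - a) + (\<gamma> - \<beta>) * \<eta>"
  define Z where "Z = \<alpha> * a"
  have nn: "0 \<le> \<beta> - \<alpha>" "0 \<le> \<gamma> - \<beta>" using ord by auto
  have nonneg: "0 \<le> X" "0 \<le> Y" "0 \<le> Z"
    using nn \<mu> \<xi> ord abc by (auto simp: X_def Y_def Z_def)
  have "c * (1 - b) * \<alpha> \<le> (1 - b) * Y + c * Z"
  proof -
    have "(1 - b) * Y + c * Z = \<alpha> * (\<Delta> + c * (1 - b)) + (1 - b) * ((\<gamma> - \<beta>) * \<eta>)"
      by (simp add: Y_def Z_def \<Delta>_eq algebra_simps)
    moreover have "0 \<le> (1 - b) * ((\<gamma> - \<beta>) * \<eta>)" "0 \<le> \<alpha> * \<Delta>" using nn \<xi> abc \<Delta> ord by auto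
    ultimately show ?thesis by (simp add: algebra_simps)
  qed
  moreover have "a * (1 - c) * \<beta> \<le> (1 - c) * Z + a * X"
  proof -
    have "a * ((\<beta> - \<alpha>) * (1 - c)) \<le> a * ((\<beta> - \<alpha>) * \<mu>)"
      using \<mu> nn abc by (intro mult_left_mono) auto
    moreover have "0 \<le> a * ((\<gamma> - \<beta>) * \<xi>)" using nn \<xi> abc by simp
    ultimately show ?thesis by (simp add: X_def Z_def algebra_simps)
  qed
  moreover have "b * (1 - a) * \<gamma> \<le> (1 - a) * X + b * Y"
  proof -
    have "(1 - a) * X + b * Y = (1 - a) * ((\<beta> - \<alpha>) * \<mu>) + (\<gamma> - \<beta>) * ((1 - a) * \<xi> + b * \<eta>) + b * \<alpha> * (1 - a)"
      by (simp add: X_def Y_def algebra_simps)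
    moreover have "(1 - a) * ((\<beta> - \<alpha>) * b) \<le> (1 - a) * ((\<beta> - \<alpha>) * \<mu>)"
      using \<mu> nn abc by (intro mult_left_mono) auto
    ultimately show ?thesis unfolding \<xi>(3) by (simp add: algebra_simps)
  qed
  moreover have "X + Y + Z \<le> \<Delta> + c * (1 - b) * \<alpha> + a * (1 - c) * \<beta> + b * (1 - a) * \<gamma>"
  proof -
    have "X + Y + Z = \<alpha> * 1 + (\<beta> - \<alpha>) * \<mu> + (\<gamma> - \<beta>) * (\<xi> + \<eta>)"
      by (simp add: X_def Y_def Z_def algebra_simps)
    also have "\<dots> \<le> \<alpha> * 1 + (\<beta> - \<alpha>) * (1 - c * (1 - b)) + (\<gamma> - \<beta>) * (1 - c * (1 - b) - a * (1 - c))"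
      using nn \<mu>_le \<xi>(4) ord by (intro add_mono mult_left_mono) auto
    also have "\<dots> = \<gamma> * \<Delta> + c * (1 - b) * \<alpha> + a * (1 - c) * \<beta> + b * (1 - a) * \<gamma>"
      by (simp add: \<Delta>_eq algebra_simps)
    also have "\<gamma> * \<Delta> \<le> 1 * \<Delta>" using ord \<Delta> by (intro mult_right_mono) auto
    finally show ?thesis by simp
  qed
  ultimately show ?thesis using nonneg unfolding corner_shift_def \<Delta>_def by blast
qed

text \<open>The constraint at \<open>A\<close> is void, so \<open>Z = 0\<close> is taken. With
  \<open>s = (1 - c) * \<beta>\<close> and \<open>t = b * \<gamma>\<close>, the others ask for
  \<open>X \<ge> s\<close> and \<open>(1 - a) * X + b * Y \<ge> (1 - a) * t\<close>. If
  \<open>b \<le> 1 - a\<close>, raising \<open>X\<close> to \<open>t\<close> is cheapest; otherwise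
  \<open>Y\<close> covers what \<open>X = s\<close> leaves. The hypotheses \<open>comp\<close> bound
  what the negative \<open>\<alpha>\<close> takes from the budget.\<close>

lemma corner_shift_neg:
  assumes abc: "0 < a" "a < 1" "0 < b" "b < 1" "0 < c" "c < 1"
    and le1: "\<beta> \<le> 1" "\<gamma> \<le> 1" and \<alpha>: "\<alpha> \<le> 0"
    and comp: "0 \<le> c * \<alpha> + (1 - c) * \<beta>" "0 \<le> b * \<gamma> + (1 - b) * \<alpha>"
    and ord: "(1 - c) * \<beta> \<le> b * \<gamma>"
  shows "corner_shift a b c \<alpha> \<beta> \<gamma>"
proof -
  define s where "s = (1 - c) * \<beta>"
  define t where "t = b * \<gamma>"
  have "c * \<alpha> \<le> 0" using abc \<alpha> by (simp add: mult_nonneg_nonpos)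
  then have s: "0 \<le> s" "s \<le> 1 - c" using comp le1 abc by (auto simp: s_def)
  have t: "s \<le> t" "t \<le> b" using ord le1 abc by (auto simp: s_def t_def)
  have d1: "- (c * (1 - b) * \<alpha>) \<le> (1 - b) * s"
    using mult_left_mono[OF comp(1), of "1 - b"] abc by (simp add: s_def algebra_simps)
  have d2: "- (c * (1 - b) * \<alpha>) \<le> c * t"
    using mult_left_mono[OF comp(2), of c] abc by (simp add: t_def algebra_simps)
  have neg: "c * (1 - b) * \<alpha> \<le> 0" using abc \<alpha> by (simp add: mult_nonneg_nonpos)
  show ?thesis
  proof (cases "b \<le> 1 - a")
    case True
    have "a * t + (1 - a - b) * s \<le> a * b + (1 - a - b) * (1 - c)"
      using True s t abc by (intro add_mono mult_left_mono) auto
    then have "t \<le> a * b * c + (1 - a) * (1 - b) * (1 - c) + c * (1 - b) * \<alpha> + a * s + (1 - a) * t"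
      using d1 by (simp add: algebra_simps)
    moreover have "a * s \<le> a * t" using t abc by simp
    ultimately show ?thesis unfolding corner_shift_def using s t neg
      by (intro exI[of _ t] exI[of _ 0] conjI) (auto simp: s_def t_def algebra_simps)
  next
    case False
    define y where "y = (1 - a) * (t - s) / b"
    have yb: "b * y = (1 - a) * (t - s)" using abc by (simp add: y_def)
    have y: "0 \<le> y" using abc t by (simp add: y_def)
    have "b * ((1 - b) * y) = (1 - b) * ((1 - a) * (t - s))" by (simp flip: yb)
    also have "\<dots> \<le> (1 - b) * ((1 - a) * (b - s))"
      using abc t by (intro mult_left_mono) auto
    also have "\<dots> \<le> b * (a * b * c + (1 - a) * (1 - b) * (1 - c) + c * (1 - b) * \<alpha>)"
    proof -
      have "- (c * (1 - b) * \<alpha>) \<le> c * b"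
        by (rule order_trans[OF d2 mult_left_mono[OF t(2)]]) (use abc in simp)
      from mult_left_mono[OF this, of "a + b - 1"] mult_left_mono[OF d1, of "1 - a"]
      show ?thesis using False abc by (simp add: algebra_simps)
    qed
    finally have "(1 - b) * y \<le> a * b * c + (1 - a) * (1 - b) * (1 - c) + c * (1 - b) * \<alpha>"
      using abc by simp
    then have "s + y \<le> a * b * c + (1 - a) * (1 - b) * (1 - c) + c * (1 - b) * \<alpha> + a * s + (1 - a) * t"
      using yb by (simp add: algebra_simps)
    moreover have "0 \<le> (1 - b) * y" using abc y by simp
    ultimately show ?thesis unfolding corner_shift_def using s y neg yb
      by (intro exI[of _ s] exI[of _ y] exI[of _ 0] conjI) (auto simp: s_def t_def algebra_simps)
  qed
qed

lemma corner_shift_nonpos: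
  assumes abc: "0 < a" "a < 1" "0 < b" "b < 1" "0 < c" "c < 1"
    and le1: "\<beta> \<le> 1" "\<gamma> \<le> 1" and \<alpha>: "\<alpha> \<le> 0"
    and comp: "0 \<le> c * \<alpha> + (1 - c) * \<beta>" "0 \<le> b * \<gamma> + (1 - b) * \<alpha>"
  shows "corner_shift a b c \<alpha> \<beta> \<gamma>"
proof (cases "(1 - c) * \<beta> \<le> b * \<gamma>")
  case True then show ?thesis using assms by (intro corner_shift_neg)
next
  case False
  show ?thesis
    by (rule corner_shift_reflect, rule corner_shift_neg) (use False assms in \<open>auto simp: algebra_simps\<close>)
qed

text \<open>By the symmetries, either a nonpositive depth or the smallest of three nonnegative
  depths may be placed at \<open>A\<close>.\<close>

lemma corner_shift_exists:
  assumes abc: "0 < a" "a < 1" "0 < b" "b < 1" "0 < c" "c < 1"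
    and le1: "\<alpha> \<le> 1" "\<beta> \<le> 1" "\<gamma> \<le> 1"
    and comp: "0 \<le> c * \<alpha> + (1 - c) * \<beta>" "0 \<le> a * \<beta> + (1 - a) * \<gamma>" "0 \<le> b * \<gamma> + (1 - b) * \<alpha>"
  shows "corner_shift a b c \<alpha> \<beta> \<gamma>"
proof -
  have sorted: "corner_shift a b c \<alpha> \<beta> \<gamma>"
    if abc: "0 < a" "a < 1" "0 < b" "b < 1" "0 < c" "c < 1"
    and "0 \<le> \<alpha>" "\<alpha> \<le> \<beta>" "\<alpha> \<le> \<gamma>" "\<beta> \<le> 1" "\<gamma> \<le> 1" for a b c \<alpha> \<beta> \<gamma>
  proof (cases "\<beta> \<le> \<gamma>")
    case True then show ?thesis using that by (intro corner_shift_nonneg)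
  next
    case False
    show ?thesis by (rule corner_shift_reflect, rule corner_shift_nonneg) (use False that in auto)
  qed
  consider "\<alpha> \<le> 0" | "\<beta> \<le> 0" | "\<gamma> \<le> 0" | "0 \<le> \<alpha>" "\<alpha> \<le> \<beta>" "\<alpha> \<le> \<gamma>"
    | "0 \<le> \<beta>" "\<beta> \<le> \<gamma>" "\<beta> \<le> \<alpha>" | "0 \<le> \<gamma>" "\<gamma> \<le> \<alpha>" "\<gamma> \<le> \<beta>" by linarith
  then show ?thesis
  proof cases
    case 1 then show ?thesis using assms by (intro corner_shift_nonpos)
  next
    case 2 then show ?thesis using assms by (intro corner_shift_rotate[of b c a \<beta> \<gamma> \<alpha>] corner_shift_nonpos)
  next
    case 3
    then show ?thesis using assms
      by (intro corner_shift_rotate[of b c a \<beta> \<gamma> \<alpha>] corner_shift_rotate[of c a b \<gamma> \<alpha> \<beta>] corner_shift_nonpos)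
  next
    case 4 then show ?thesis using assms by (intro sorted)
  next
    case 5 then show ?thesis using assms by (intro corner_shift_rotate[of b c a \<beta> \<gamma> \<alpha>] sorted)
  next
    case 6
    then show ?thesis using assms
      by (intro corner_shift_rotate[of b c a \<beta> \<gamma> \<alpha>] corner_shift_rotate[of c a b \<gamma> \<alpha> \<beta>] sorted)
  qed
qed

text \<open>In the quadrant, beyond the line through \<open>(c, 0)\<close> and
  \<open>(0, w)\<close>, a linear function with nonnegative coefficients is minimal at one of these
  two points.\<close>

lemma above_line_min:
  fixes P Q x y c w :: real
  assumes "0 < c" "0 < w" "0 \<le> x" "0 \<le> y" "c * w \<le> w * x + c * y" "0 \<le> P" "0 \<le> Q"
  shows "min (P * c) (Q * w) \<le> P * x + Q * y"
proof -
  define m where "m = min (P * c) (Q * w)"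
  have m: "0 \<le> m" "m \<le> P * c" "m \<le> Q * w" using assms by (auto simp: m_def)
  have "(c * w) * m \<le> (w * x + c * y) * m" using assms m by (intro mult_right_mono) auto
  also have "\<dots> = (w * x) * m + (c * y) * m" by (simp add: algebra_simps)
  also have "\<dots> \<le> (w * x) * (P * c) + (c * y) * (Q * w)"
    using assms m by (intro add_mono mult_left_mono) auto
  also have "\<dots> = (c * w) * (P * x + Q * y)" by (simp add: algebra_simps)
  finally show ?thesis using assms by (simp add: m_def)
qed

locale inscribed =
  fixes K :: "(real^2) set"
  assumes K2: "K \<in> K2"
    and left: "supp K (vec2 (-1) 0) = 0" and bot: "supp K (vec2 0 (-1)) = 0"
    and diag: "supp K (vec2 1 1) = 1"
begin

lemma bounds:
  assumes "x \<in> K" shows "0 \<le> x$1" "0 \<le> x$2" "x$1 + x$2 \<le> 1"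
  using le_supp[OF K2 assms, of "vec2 (-1) 0"] le_supp[OF K2 assms, of "vec2 0 (-1)"]
    le_supp[OF K2 assms, of "vec2 1 1"] by (auto simp: left bot diag inner_2)

lemma touching:
  obtains a b c where "vec2 (1 - a) a \<in> K" "vec2 0 (1 - b) \<in> K" "vec2 c 0 \<in> K"
    "0 \<le> a" "a \<le> 1" "0 \<le> b" "b \<le> 1" "0 \<le> c" "c \<le> 1"
proof -
  obtain p where p: "p \<in> K" "p \<bullet> vec2 1 1 = 1" using supp_attained[OF K2] diag by metis
  obtain q where q: "q \<in> K" "q \<bullet> vec2 (-1) 0 = 0" using supp_attained[OF K2] left by metis
  obtain r where r: "r \<in> K" "r \<bullet> vec2 0 (-1) = 0" using supp_attained[OF K2] bot by metis
  have "vec2 (1 - p$2) (p$2) = p" "vec2 0 (1 - (1 - q$2)) = q" "vec2 (r$1) 0 = r"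
    using p q r by (auto simp: vec_eq_iff forall_2 inner_2)
  then show ?thesis using that[of "p$2" "1 - q$2" "r$1"] p(1) q(1) r(1) bounds[OF p(1)] bounds[OF q(1)] bounds[OF r(1)]
    by auto
qed

lemma mixed_std: "2 * mixed_area std_triangle K = 1"
  by (simp add: mixed_area_std_triangle[OF K2] left bot diag)

end

text \<open>Only the triangle of contact points of \<open>K\<close> is used. Each cone on which the
  support function of the standard triangle is linear involves two contact points, and the corner
  condition between them gives the bound there.\<close>

lemma inscribed_shift:
  assumes "inscribed K" "inscribed M"
    and abc: "0 < a" "a < 1" "0 < b" "b < 1" "0 < c" "c < 1"
    and p: "vec2 (1 - a) a \<in> K" and q: "vec2 0 (1 - b) \<in> K" and r: "vec2 c 0 \<in> K"
  shows "\<exists>z. \<forall>u. z \<bullet> u + supp M u \<le> supp K u + 2 * mixed_area K M * supp std_triangle u"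
proof -
  interpret K: inscribed K by fact
  interpret M: inscribed M by fact
  \<comment> \<open>minima over \<open>M\<close> of the affine functions that vanish at \<open>A\<close>, \<open>B\<close>, \<open>C\<close> and are constant on \<open>qr\<close>, \<open>rp\<close>, \<open>pq\<close>\<close>
  define mA where "mA = - supp M (vec2 (b - 1) (- c))"
  define mB where "mB = a - supp M (vec2 a (a + c - 1))"
  define mC where "mC = 1 - a - supp M (vec2 (1 - a - b) (1 - a))"
  have mA: "mA \<le> (1 - b) * x$1 + c * x$2" if "x \<in> M" for x
    using le_supp[OF M.K2 that, of "vec2 (b - 1) (- c)"] by (simp add: mA_def inner_2 algebra_simps)
  have mB: "mB \<le> a * (1 - x$1 - x$2) + (1 - c) * x$2" if "x \<in> M" for x
    using le_supp[OF M.K2 that, of "vec2 a (a + c - 1)"] by (simp add: mB_def inner_2 algebra_simps)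
  have mC: "mC \<le> (1 - a) * (1 - x$1 - x$2) + b * x$1" if "x \<in> M" for x
    using le_supp[OF M.K2 that, of "vec2 (1 - a - b) (1 - a)"] by (simp add: mC_def inner_2 algebra_simps)
  have nonneg: "0 \<le> mA" "0 \<le> mB" "0 \<le> mC"
  proof -
    have *: "0 \<le> (1 - b) * x$1 + c * x$2" "0 \<le> a * (1 - x$1 - x$2) + (1 - c) * x$2"
      "0 \<le> (1 - a) * (1 - x$1 - x$2) + b * x$1" if "x \<in> M" for x
      using M.bounds[OF that] abc by (auto intro!: add_nonneg_nonneg mult_nonneg_nonneg)
    have "supp M (vec2 (b - 1) (- c)) \<le> 0" "supp M (vec2 a (a + c - 1)) \<le> a"
      "supp M (vec2 (1 - a - b) (1 - a)) \<le> 1 - a"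
      unfolding supp_le_iff[OF M.K2] using * by (auto simp: inner_2 algebra_simps)
    then show "0 \<le> mA" "0 \<le> mB" "0 \<le> mC" by (auto simp: mA_def mB_def mC_def)
  qed
  define s where "s = 2 * mixed_area K M"
  \<comment> \<open>Replacing \<open>K\<close> by its contact triangle does not increase the mixed
    area, which is then explicit.\<close>
  have s: "1 - mA - mB - mC \<le> s"
  proof -
    let ?T = "convex hull {vec2 c 0, vec2 (1 - a) a, vec2 0 (1 - b)}"
    have "?T \<subseteq> K" using K.K2 p q r by (intro hull_minimal) (auto simp: K2_def)
    then have le: "mixed_area ?T M \<le> mixed_area K M"
      by (intro mixed_area_mono tri_K2 K.K2 M.K2)
    have "cross2 (vec2 (1 - a) a - vec2 c 0) (vec2 0 (1 - b) - vec2 c 0)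
        = a * b * c + (1 - a) * (1 - b) * (1 - c)"
      by (simp add: cross2_def algebra_simps)
    moreover have "0 < a * b * c + (1 - a) * (1 - b) * (1 - c)"
      using abc by (intro add_pos_pos mult_pos_pos) auto
    ultimately have pos: "0 < cross2 (vec2 (1 - a) a - vec2 c 0) (vec2 0 (1 - b) - vec2 c 0)"
      by (simp only:)
    have rots: "rot (vec2 (1 - a) a - vec2 c 0) = vec2 a (a + c - 1)"
      "rot (vec2 0 (1 - b) - vec2 (1 - a) a) = vec2 (1 - a - b) (1 - a)"
      "rot (vec2 c 0 - vec2 0 (1 - b)) = vec2 (b - 1) (- c)"
      by (simp_all add: rot_def vec_eq_iff forall_2)
    show ?thesis
      using mixed_area_tri[OF M.K2 pos, unfolded rots] le
      unfolding s_def mA_def mB_def mC_def by linarith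
  qed
  define \<alpha> where "\<alpha> = 1 - mA / (c * (1 - b))"
  define \<beta> where "\<beta> = 1 - mB / (a * (1 - c))"
  define \<gamma> where "\<gamma> = 1 - mC / (b * (1 - a))"
  have weights: "c * \<alpha> = c - mA / (1 - b)" "(1 - b) * \<alpha> = 1 - b - mA / c"
    "a * \<beta> = a - mB / (1 - c)" "(1 - c) * \<beta> = 1 - c - mB / a"
    "b * \<gamma> = b - mC / (1 - a)" "(1 - a) * \<gamma> = 1 - a - mC / b"
  proof -
    have aux: "x * (1 - m / (x * y)) = x - m / y" "y * (1 - m / (x * y)) = y - m / x"
      if "x \<noteq> 0" "y \<noteq> 0" for x y m :: real
      using that by (auto simp: field_simps)
    show "c * \<alpha> = c - mA / (1 - b)" "(1 - b) * \<alpha> = 1 - b - mA / c"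
      "a * \<beta> = a - mB / (1 - c)" "(1 - c) * \<beta> = 1 - c - mB / a"
      "b * \<gamma> = b - mC / (1 - a)" "(1 - a) * \<gamma> = 1 - a - mC / b"
      unfolding \<alpha>_def \<beta>_def \<gamma>_def using abc by (intro aux; simp)+
  qed
  have "corner_shift a b c \<alpha> \<beta> \<gamma>"
  proof (rule corner_shift_exists[OF abc])
    show "\<alpha> \<le> 1" "\<beta> \<le> 1" "\<gamma> \<le> 1" using nonneg abc by (auto simp: \<alpha>_def \<beta>_def \<gamma>_def)
    \<comment> \<open>A contact point of \<open>M\<close> at position \<open>c'\<close> on
      \<open>AB\<close> gives \<open>c * \<alpha> \<ge> c - c'\<close> and
      \<open>(1 - c) * \<beta> \<ge> c' - c\<close>; the sum is nonnegative. The other sides are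
      alike.\<close>
    obtain a' b' c' where t: "vec2 (1 - a') a' \<in> M" "vec2 0 (1 - b') \<in> M" "vec2 c' 0 \<in> M"
      using M.touching by metis
    have "mA \<le> (1 - b) * c'" "mB \<le> a * (1 - c')" using mA[OF t(3)] mB[OF t(3)] by auto
    then have "mA / (1 - b) \<le> c'" "mB / a \<le> 1 - c'" using abc by (auto simp: field_simps)
    then show "0 \<le> c * \<alpha> + (1 - c) * \<beta>" unfolding weights by linarith
    have "mB \<le> (1 - c) * a'" "mC \<le> b * (1 - a')" using mB[OF t(1)] mC[OF t(1)] by auto
    then have "mB / (1 - c) \<le> a'" "mC / b \<le> 1 - a'" using abc by (auto simp: field_simps)
    then show "0 \<le> a * \<beta> + (1 - a) * \<gamma>" unfolding weights by linarith
    have "mC \<le> (1 - a) * b'" "mA \<le> c * (1 - b')" using mC[OF t(2)] mA[OF t(2)] by auto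
    then have "mC / (1 - a) \<le> b'" "mA / c \<le> 1 - b'" using abc by (auto simp: field_simps)
    then show "0 \<le> b * \<gamma> + (1 - b) * \<alpha>" unfolding weights by linarith
  qed
  moreover have offsets: "c * (1 - b) * \<alpha> = c * (1 - b) - mA" "a * (1 - c) * \<beta> = a * (1 - c) - mB"
    "b * (1 - a) * \<gamma> = b * (1 - a) - mC"
  proof -
    have aux: "x * (1 - m / x) = x - m" if "x \<noteq> 0" for x m :: real
      using that by (simp add: field_simps)
    show "c * (1 - b) * \<alpha> = c * (1 - b) - mA" "a * (1 - c) * \<beta> = a * (1 - c) - mB"
      "b * (1 - a) * \<gamma> = b * (1 - a) - mC"
      unfolding \<alpha>_def \<beta>_def \<gamma>_def using abc by (intro aux; simp)+
  qed
  ultimately obtain X Y Z where XYZ: "0 \<le> X" "0 \<le> Y" "0 \<le> Z"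
    and A: "c * (1 - b) - mA \<le> (1 - b) * Y + c * Z"
    and B: "a * (1 - c) - mB \<le> (1 - c) * Z + a * X"
    and C: "b * (1 - a) - mC \<le> (1 - a) * X + b * Y"
    and sum: "X + Y + Z \<le> a * b * c + (1 - a) * (1 - b) * (1 - c)
       + (c * (1 - b) - mA) + (a * (1 - c) - mB) + (b * (1 - a) - mC)"
    unfolding corner_shift_def offsets by blast
  have "a * b * c + (1 - a) * (1 - b) * (1 - c) + (c * (1 - b) - mA) + (a * (1 - c) - mB)
      + (b * (1 - a) - mC) = 1 - mA - mB - mC" by (simp add: algebra_simps)
  with sum s have sum: "X + Y + Z \<le> s" by linarith
  have s0: "0 \<le> s" using sum XYZ by linarith
  have "vec2 Y Z \<bullet> u + m \<bullet> u \<le> supp K u + s * supp std_triangle u" if m: "m \<in> M" for u m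
  proof -
    have p': "(1 - a) * u$1 + a * u$2 \<le> supp K u" and q': "(1 - b) * u$2 \<le> supp K u"
      and r': "c * u$1 \<le> supp K u"
      using le_supp[OF K.K2 p, of u] le_supp[OF K.K2 q, of u] le_supp[OF K.K2 r, of u]
      by (auto simp: inner_2)
    \<comment> \<open>Coordinates of the translated point relative to the enlarged triangle;
      \<open>zA\<close> completes the sum to \<open>1 + (X + Y + Z)\<close>.\<close>
    define zA where "zA = 1 - m$1 - m$2 + X"
    define zB where "zB = m$1 + Y"
    define zC where "zC = m$2 + Z"
    have z0: "0 \<le> zA" "0 \<le> zB" "0 \<le> zC"
      using M.bounds[OF m] XYZ by (auto simp: zA_def zB_def zC_def)
    have lA: "c * (1 - b) \<le> (1 - b) * zB + c * zC"
      using A mA[OF m] by (simp add: zB_def zC_def algebra_simps)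
    have lB: "(1 - c) * a \<le> a * zA + (1 - c) * zC"
      using B mB[OF m] by (simp add: zA_def zC_def algebra_simps)
    have lC: "b * (1 - a) \<le> (1 - a) * zA + b * zB"
      using C mC[OF m] by (simp add: zA_def zB_def algebra_simps)
    have lhs: "vec2 Y Z \<bullet> u + m \<bullet> u = u$1 * zB + u$2 * zC"
      by (simp add: zB_def zC_def inner_2 algebra_simps)
    have total: "zA + zB + zC = 1 + (X + Y + Z)" by (simp add: zA_def zB_def zC_def)
    consider "u$1 \<le> 0" "u$2 \<le> 0" | "0 \<le> u$1" "u$2 \<le> u$1" | "0 \<le> u$2" "u$1 \<le> u$2" by linarith
    then show ?thesis
    proof cases
      case 1
      have "min ((- u$1) * c) ((- u$2) * (1 - b)) \<le> (- u$1) * zB + (- u$2) * zC"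
        using lA z0 abc 1 by (intro above_line_min) auto
      moreover have "supp std_triangle u = 0" using 1 by (simp add: supp_std_triangle)
      ultimately show ?thesis using q' r' unfolding lhs by (auto simp: min_def algebra_simps split: if_splits)
    next
      case 2
      have "min (u$1 * (1 - c)) ((u$1 - u$2) * a) \<le> u$1 * zA + (u$1 - u$2) * zC"
        using lB z0 abc 2 by (intro above_line_min) auto
      moreover have "u$1 * zB + u$2 * zC = u$1 * (zA + zB + zC) - (u$1 * zA + (u$1 - u$2) * zC)"
        by (simp add: algebra_simps)
      moreover have "u$1 * (zA + zB + zC) \<le> u$1 * (1 + s)"
        unfolding total using sum 2 by (intro mult_left_mono) auto
      moreover have "supp std_triangle u = u$1" using 2 by (simp add: supp_std_triangle)
      ultimately show ?thesis using p' r' unfolding lhs by (auto simp: min_def algebra_simps split: if_splits)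
    next
      case 3
      have "min (u$2 * b) ((u$2 - u$1) * (1 - a)) \<le> u$2 * zA + (u$2 - u$1) * zB"
        using lC z0 abc 3 by (intro above_line_min) auto
      moreover have "u$1 * zB + u$2 * zC = u$2 * (zA + zB + zC) - (u$2 * zA + (u$2 - u$1) * zB)"
        by (simp add: algebra_simps)
      moreover have "u$2 * (zA + zB + zC) \<le> u$2 * (1 + s)"
        unfolding total using sum 3 by (intro mult_left_mono) auto
      moreover have "supp std_triangle u = u$2" using 3 by (simp add: supp_std_triangle)
      ultimately show ?thesis using p' q' unfolding lhs by (auto simp: min_def algebra_simps split: if_splits)
    qed
  qed
  then have "vec2 Y Z \<bullet> u + supp M u \<le> supp K u + s * supp std_triangle u" for u
    by (metis M.K2 supp_attained)
  then show ?thesis unfolding s_def by blast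
qed

lemma mixed_area_le_if_supp:
  assumes "M \<in> K2" "C \<in> K2" "L \<in> K2" and le: "\<And>u. z \<bullet> u + supp M u \<le> supp C u"
  shows "mixed_area M L \<le> mixed_area C L"
proof -
  have "(+) z ` M \<subseteq> C" using assms by (intro subset_if_supp translate_K2) (auto simp: supp_translate)
  then show ?thesis
    using mixed_area_mono[OF translate_K2[OF assms(1)] assms(2,3)] by (simp add: mixed_area_translate assms)
qed

lemma nonpos_if_le_eps:
  fixes x C :: real
  assumes "\<And>e. 0 < e \<Longrightarrow> x \<le> e * C"
  shows "x \<le> 0"
proof (rule ccontr)
  assume "\<not> x \<le> 0"
  then have x: "0 < x" by simp
  have "x \<le> (x / (\<bar>C\<bar> + 1)) * C" using x by (intro assms) simp
  also have "\<dots> \<le> (x / (\<bar>C\<bar> + 1)) * \<bar>C\<bar>" using x by (intro mult_left_mono) auto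
  also have "\<dots> < x" using x by (simp add: field_simps)
  finally show False by simp
qed

lemma inscribed_inequality_interior:
  assumes "inscribed K" "inscribed M" "L \<in> K2"
    and abc: "0 < a" "a < 1" "0 < b" "b < 1" "0 < c" "c < 1"
    and "vec2 (1 - a) a \<in> K" "vec2 0 (1 - b) \<in> K" "vec2 c 0 \<in> K"
  shows "mixed_area M L \<le> mixed_area K L + 2 * mixed_area K M * mixed_area std_triangle L"
proof -
  interpret K: inscribed K by fact
  interpret M: inscribed M by fact
  define t where "t = 2 * mixed_area K M"
  have t: "0 \<le> t" unfolding t_def using mixed_area_nonneg[OF K.K2 M.K2] by simp
  obtain z where z: "\<And>u. z \<bullet> u + supp M u \<le> supp K u + t * supp std_triangle u"
    using inscribed_shift[OF assms(1,2,4-12)] unfolding t_def by blast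
  have "mixed_area M L \<le> mixed_area (minkowski_sum K ((*\<^sub>R) t ` std_triangle)) L"
    using z t by (intro mixed_area_le_if_supp[of _ _ _ z] minkowski_sum_K2 scale_K2)
      (auto simp: supp_minkowski_sum supp_scale_image scale_K2 std_triangle_K2 M.K2 K.K2 assms(3))
  also have "\<dots> = mixed_area K L + t * mixed_area std_triangle L"
    using t by (simp add: mixed_area_add mixed_area_scale scale_K2 std_triangle_K2 K.K2 assms(3))
  finally show ?thesis by (simp add: t_def)
qed

text \<open>Contact points at vertices would make denominators vanish. They are avoided by a
  perturbation whose error is linear in \<open>e\<close>.\<close>

lemma inscribed_inequality:
  assumes "inscribed K" "inscribed M" "L \<in> K2"
  shows "mixed_area M L \<le> mixed_area K L + 2 * mixed_area K M * mixed_area std_triangle L"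
proof -
  interpret K: inscribed K by fact
  interpret M: inscribed M by fact
  let ?S = std_triangle
  obtain a b c where t: "vec2 (1 - a) a \<in> K" "vec2 0 (1 - b) \<in> K" "vec2 c 0 \<in> K"
    and abc: "0 \<le> a" "a \<le> 1" "0 \<le> b" "b \<le> 1" "0 \<le> c" "c \<le> 1" by (rule K.touching)
  have "mixed_area M L - mixed_area K L - 2 * mixed_area K M * mixed_area ?S L
      \<le> e * (2 * mixed_area ?S L - mixed_area M L)" if e: "0 < e" for e
  proof -
    \<comment> \<open>moves the points of contact into the interior of the sides\<close>
    define C where "C = (*\<^sub>R) (1 / (1 + e)) ` minkowski_sum K ((*\<^sub>R) e ` ?S)"
    have C: "C \<in> K2" unfolding C_def by (intro scale_K2 minkowski_sum_K2 K.K2 std_triangle_K2)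
    have supp_C: "supp C u = (supp K u + e * supp ?S u) / (1 + e)" for u
      using e by (simp add: C_def supp_scale_image supp_minkowski_sum minkowski_sum_K2 scale_K2 K.K2 std_triangle_K2)
    have mixed_C: "mixed_area C N = (mixed_area K N + e * mixed_area ?S N) / (1 + e)" if "N \<in> K2" for N
      using e that by (simp add: C_def mixed_area_scale mixed_area_add minkowski_sum_K2 scale_K2 K.K2 std_triangle_K2)
    have ins: "inscribed C"
      by unfold_locales (use e in \<open>simp_all add: C supp_C K.left K.bot K.diag supp_std_triangle\<close>)
    have mem: "vec2 ((x + e * v) / (1 + e)) ((y + e * w) / (1 + e)) \<in> C"
      if "vec2 x y \<in> K" "vec2 v w \<in> ?S" for x y v w
    proof -
      have "vec2 ((x + e * v) / (1 + e)) ((y + e * w) / (1 + e)) = (1 / (1 + e)) *\<^sub>R (vec2 x y + e *\<^sub>R vec2 v w)"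
        by (simp add: vec2_scale vec2_add)
      then show ?thesis using that unfolding C_def minkowski_sum_def by blast
    qed
    have S: "vec2 v w \<in> ?S" if "0 \<le> v" "0 \<le> w" "v + w \<le> 1" for v w
      unfolding std_triangle_def convex_hull_3
      using that by (intro CollectI exI[of _ "1 - v - w"] exI[of _ v] exI[of _ w]) (auto simp: vec_eq_iff forall_2)
    define a' where "a' = (a + e * (1/2)) / (1 + e)"
    define b' where "b' = (b + e * (1/2)) / (1 + e)"
    define c' where "c' = (c + e * (1/2)) / (1 + e)"
    have "1 - a' = (1 - a + e * (1/2)) / (1 + e)" "1 - b' = (1 - b + e * (1/2)) / (1 + e)"
      using e by (auto simp: a'_def b'_def field_simps)
    then have "vec2 (1 - a') a' \<in> C" "vec2 0 (1 - b') \<in> C" "vec2 c' 0 \<in> C"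
      using mem[OF t(1) S[of "1/2" "1/2"]] mem[OF t(2) S[of 0 "1/2"]] mem[OF t(3) S[of "1/2" 0]]
      by (simp_all add: a'_def c'_def)
    moreover have "0 < a'" "a' < 1" "0 < b'" "b' < 1" "0 < c'" "c' < 1"
      using e abc by (auto simp: a'_def b'_def c'_def field_simps)
    ultimately have "mixed_area M L \<le> mixed_area C L + 2 * mixed_area C M * mixed_area ?S L"
      by (intro inscribed_inequality_interior ins assms)
    then have "(1 + e) * mixed_area M L \<le> (1 + e) * (mixed_area C L + 2 * mixed_area C M * mixed_area ?S L)"
      using e by simp
    also have "\<dots> = (1 + e) * mixed_area C L + 2 * ((1 + e) * mixed_area C M) * mixed_area ?S L"
      by (simp add: algebra_simps)
    also have "\<dots> = mixed_area K L + e * mixed_area ?S L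
        + (2 * mixed_area K M + e * (2 * mixed_area ?S M)) * mixed_area ?S L"
      using e by (simp add: mixed_C assms(3) M.K2)
    finally show ?thesis unfolding M.mixed_std by (simp add: algebra_simps)
  qed
  then have "mixed_area M L - mixed_area K L - 2 * mixed_area K M * mixed_area ?S L \<le> 0"
    by (rule nonpos_if_le_eps)
  then show ?thesis by simp
qed

section \<open>The inequality for arbitrary bodies\<close>

text \<open>Twice this mixed area is the size of the circumscribed homothetic copy of the standard
  triangle; size zero forces a point.\<close>

lemma mixed_area_std_pos_or_singleton:
  assumes K: "K \<in> K2"
  shows "0 < mixed_area std_triangle K \<or> (\<exists>x. K = {x})"
proof (rule disjCI, rule ccontr)
  assume "\<nexists>x. K = {x}" and "\<not> 0 < mixed_area std_triangle K"
  then have 0: "supp K (vec2 (-1) 0) + supp K (vec2 0 (-1)) + supp K (vec2 1 1) \<le> 0"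
    using mixed_area_std_triangle[OF K] by simp
  have "x = vec2 (- supp K (vec2 (-1) 0)) (- supp K (vec2 0 (-1)))" if "x \<in> K" for x
    using 0 le_supp[OF K that, of "vec2 (-1) 0"] le_supp[OF K that, of "vec2 0 (-1)"]
      le_supp[OF K that, of "vec2 1 1"] by (simp add: vec_eq_iff forall_2 inner_2)
  moreover obtain x where "x \<in> K" using K by (auto simp: K2_def)
  ultimately have "K = {vec2 (- supp K (vec2 (-1) 0)) (- supp K (vec2 0 (-1)))}" by blast
  with \<open>\<nexists>x. K = {x}\<close> show False by blast
qed

definition normalize :: "(real^2) set \<Rightarrow> (real^2) set" where
  "normalize K = (*\<^sub>R) (1 / (2 * mixed_area std_triangle K)) `
     ((+) (vec2 (supp K (vec2 (-1) 0)) (supp K (vec2 0 (-1)))) ` K)"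

lemma inscribed_normalize:
  assumes K: "K \<in> K2" and pos: "0 < mixed_area std_triangle K"
  shows "inscribed (normalize K)"
  by unfold_locales
    (use pos mixed_area_std_triangle[OF K] in \<open>simp_all add: normalize_def scale_K2 translate_K2 K supp_scale_image supp_translate inner_2\<close>)

lemma mixed_area_normalize:
  assumes K: "K \<in> K2" and pos: "0 < mixed_area std_triangle K" and "L \<in> K2"
  shows "mixed_area (normalize K) L = mixed_area K L / (2 * mixed_area std_triangle K)"
  using assms by (simp add: normalize_def mixed_area_scale mixed_area_translate translate_K2)

text \<open>The homogeneous form of \<open>inscribed_inequality\<close>; if \<open>K\<close> or
  \<open>M\<close> is a point, the left side vanishes.\<close>

lemma std_triangle_inequality:
  assumes K: "K \<in> K2" and M: "M \<in> K2" and L: "L \<in> K2"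
  shows "mixed_area std_triangle K * mixed_area M L
    \<le> mixed_area std_triangle M * mixed_area K L + mixed_area K M * mixed_area std_triangle L"
proof -
  let ?k = "mixed_area std_triangle K" and ?m = "mixed_area std_triangle M"
  consider "0 < ?k" "0 < ?m" | "\<not> 0 < ?k" | x where "M = {x}"
    using mixed_area_std_pos_or_singleton[OF M] by auto
  then show ?thesis
  proof cases
    case 1
    note ins = inscribed_normalize[OF K 1(1)] inscribed_normalize[OF M 1(2)]
    then have K': "normalize K \<in> K2" and M': "normalize M \<in> K2" by (auto dest: inscribed.K2)
    have "mixed_area (normalize K) (normalize M) = mixed_area (normalize M) K / (2 * ?k)"
      using 1 by (simp add: mixed_area_normalize K M' mixed_area_commute[of K])
    also have "\<dots> = mixed_area K M / (2 * ?m) / (2 * ?k)"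
      using 1 by (simp add: mixed_area_normalize K M mixed_area_commute[of M])
    finally have "mixed_area M L / (2 * ?m) \<le> mixed_area K L / (2 * ?k)
        + 2 * (mixed_area K M / (2 * ?m) / (2 * ?k)) * mixed_area std_triangle L"
      using inscribed_inequality[OF ins L] 1 by (simp add: mixed_area_normalize K M L)
    then have "(2 * ?m * ?k) * (mixed_area M L / (2 * ?m)) \<le> (2 * ?m * ?k) * (mixed_area K L / (2 * ?k)
        + 2 * (mixed_area K M / (2 * ?m) / (2 * ?k)) * mixed_area std_triangle L)"
      by (rule mult_left_mono) (use 1 in simp)
    moreover have "(2 * ?m * ?k) * (mixed_area M L / (2 * ?m)) = ?k * mixed_area M L"
      "(2 * ?m * ?k) * (mixed_area K L / (2 * ?k)) = ?m * mixed_area K L"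
      "(2 * ?m * ?k) * (2 * (mixed_area K M / (2 * ?m) / (2 * ?k)) * mixed_area std_triangle L)
        = mixed_area K M * mixed_area std_triangle L"
      using 1 by simp_all
    ultimately show ?thesis unfolding distrib_left by linarith
  next
    case 2
    then have "?k = 0" using mixed_area_nonneg[OF std_triangle_K2 K] by simp
    then show ?thesis using mixed_area_nonneg K M L std_triangle_K2 by simp
  next
    case 3
    then show ?thesis using mixed_area_nonneg K M L std_triangle_K2
      by (simp add: mixed_area_singleton)
  qed
qed

text \<open>For independent \<open>u\<close>, \<open>v\<close> this is twice the mixed area of \<open>K\<close> with a triangle whose outer normals are
  \<open>u\<close>, \<open>v\<close>, \<open>- u - v\<close>.\<close>
definition supp3 :: "(real^2) set \<Rightarrow> real^2 \<Rightarrow> real^2 \<Rightarrow> real" where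
  "supp3 K u v = supp K u + supp K v + supp K (- u - v)"

lemma mixed_area_supp3_inequality:
  assumes K: "K \<in> K2" and M: "M \<in> K2" and L: "L \<in> K2" and uv: "cross2 u v \<noteq> 0"
  shows "supp3 K u v * mixed_area M L \<le> supp3 M u v * mixed_area K L + mixed_area K M * supp3 L u v"
proof -
  \<comment> \<open>The adjoint of \<open>g\<close> sends the normals \<open>(-1, 0)\<close>,
    \<open>(0, -1)\<close>, \<open>(1, 1)\<close> of the standard triangle to \<open>u\<close>,
    \<open>v\<close>, \<open>- u - v\<close>.\<close>
  define g where "g = (\<lambda>x::real^2. vec2 (- (x \<bullet> u)) (- (x \<bullet> v)))"
  have g: "linear g" by (intro linearI) (auto simp: g_def vec_eq_iff forall_2 inner_add_left)
  have "det (matrix g) = cross2 u v"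
    by (simp add: det_2 matrix_def g_def cross2_def axis_def inner_2 algebra_simps)
  then have d: "\<bar>det (matrix g)\<bar> > 0" using uv by simp
  have s: "2 * mixed_area std_triangle (g ` N) = supp3 N u v" if N: "N \<in> K2" for N
  proof -
    have "supp (g ` N) (vec2 (-1) 0) = supp N u" "supp (g ` N) (vec2 0 (-1)) = supp N v"
      "supp (g ` N) (vec2 1 1) = supp N (- u - v)"
      by (intro supp_linear_image N g; simp add: g_def inner_2 algebra_simps)+
    then show ?thesis
      using mixed_area_std_triangle[OF linear_image_K2[OF N g]] by (simp add: supp3_def)
  qed
  have "2 * (mixed_area std_triangle (g ` K) * mixed_area (g ` M) (g ` L))
    \<le> 2 * (mixed_area std_triangle (g ` M) * mixed_area (g ` K) (g ` L)
      + mixed_area (g ` K) (g ` M) * mixed_area std_triangle (g ` L))"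
    using std_triangle_inequality[OF linear_image_K2[OF K g] linear_image_K2[OF M g] linear_image_K2[OF L g]] by simp
  then have "\<bar>det (matrix g)\<bar> * (supp3 K u v * mixed_area M L)
    \<le> \<bar>det (matrix g)\<bar> * (supp3 M u v * mixed_area K L + mixed_area K M * supp3 L u v)"
    unfolding s[OF K, symmetric] s[OF M, symmetric] s[OF L, symmetric]
    by (simp add: mixed_area_linear_image K M L g algebra_simps)
  then show ?thesis using d by simp
qed

section \<open>Containment up to translation by Helly's theorem\<close>

lemma solve_inner:
  assumes "cross2 u v \<noteq> 0"
  obtains z where "z \<bullet> u = p" "z \<bullet> v = q"
proof
  define z where "z = vec2 ((p * v$2 - q * u$2) / cross2 u v) ((q * u$1 - p * v$1) / cross2 u v)"
  have "(p * v$2 - q * u$2) * u$1 + (q * u$1 - p * v$1) * u$2 = p * cross2 u v"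
    "(p * v$2 - q * u$2) * v$1 + (q * u$1 - p * v$1) * v$2 = q * cross2 u v"
    by (auto simp: cross2_def algebra_simps)
  then show "z \<bullet> u = p" "z \<bullet> v = q"
    using assms by (simp_all add: z_def inner_2 add_divide_distrib[symmetric])
qed

text \<open>Segments are limits of triangles.\<close>
lemma width_le_if_supp3_le:
  assumes M: "M \<in> K2" and C: "C \<in> K2"
    and le: "\<And>u v. cross2 u v \<noteq> 0 \<Longrightarrow> supp3 M u v \<le> supp3 C u v"
  shows "width M u \<le> width C u"
proof (cases "u = 0")
  case True then show ?thesis using M C by (simp add: width_def supp_0)
next
  case False
  define r where "r = rot u"
  have "0 < u$1 * u$1 + u$2 * u$2"
    using False by (metis inner_2 inner_gt_zero_iff)
  then have cr: "cross2 u (e *\<^sub>R r) \<noteq> 0" if "0 < e" for e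
  proof -
    have "cross2 u (e *\<^sub>R r) = - (e * (u$1 * u$1 + u$2 * u$2))"
      by (simp add: cross2_def r_def rot_def algebra_simps)
    moreover have "0 < e * (u$1 * u$1 + u$2 * u$2)"
      using that \<open>0 < u$1 * u$1 + u$2 * u$2\<close> by (rule mult_pos_pos)
    ultimately show ?thesis by linarith
  qed
  have "width M u - width C u \<le> e * width C r" if e: "0 < e" for e
  proof -
    have "supp M (- u) \<le> supp M (- u - e *\<^sub>R r) + e * supp M r"
      using supp_add[OF M, of "- u - e *\<^sub>R r" "e *\<^sub>R r"] supp_scale[OF M, of e r] e by simp
    moreover have "supp C (- u - e *\<^sub>R r) \<le> supp C (- u) + e * supp C (- r)"
      using supp_add[OF C, of "- u" "e *\<^sub>R (- r)"] supp_scale[OF C, of e "- r"] e by simp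
    ultimately show ?thesis
      using le[OF cr[OF e]] e supp_scale[OF M, of e r] supp_scale[OF C, of e r]
      by (simp add: supp3_def width_def algebra_simps)
  qed
  then have "width M u - width C u \<le> 0" by (rule nonpos_if_le_eps)
  then show ?thesis by simp
qed

text \<open>The admissible translations form the intersection of the half-planes \<open>G u\<close>.
  Three of them can fail to meet only if their normals have a nontrivial nonnegative relation, and
  then \<open>supp3\<close> or a width decides.\<close>

lemma translate_subset_if_supp3_le:
  assumes M: "M \<in> K2" and C: "C \<in> K2"
    and le: "\<And>u v. cross2 u v \<noteq> 0 \<Longrightarrow> supp3 M u v \<le> supp3 C u v"
  shows "\<exists>z. \<forall>u. z \<bullet> u + supp M u \<le> supp C u"
proof -
  define f where "f u = supp C u - supp M u" for u
  define G where "G u = {z. z \<bullet> u \<le> f u}" for u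
  have "G u = {z. u \<bullet> z \<le> f u}" for u by (simp add: G_def inner_commute)
  then have G_convex: "convex (G u)" and G_closed: "closed (G u)" for u
    by (simp_all add: convex_halfspace_le closed_halfspace_le)
  have f_scale: "f (s *\<^sub>R u) = s * f u" if "0 \<le> s" for s u
    using that by (simp add: f_def supp_scale M C algebra_simps)
  have f_width: "0 \<le> f u + f (- u)" for u
    using width_le_if_supp3_le[OF M C le, of u] by (simp add: f_def width_def)
  have f3: "0 \<le> f u + f v + f (- u - v)" if "cross2 u v \<noteq> 0" for u v
    using le[OF that] by (simp add: f_def supp3_def)
  have f_comb: "0 \<le> s * f u + t * f v + f (- (s *\<^sub>R u) - t *\<^sub>R v)"
    if "cross2 u v \<noteq> 0" "0 \<le> s" "0 \<le> t" for u v s t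
  proof -
    consider "s = 0" | "t = 0" | "0 < s" "0 < t" using \<open>0 \<le> s\<close> \<open>0 \<le> t\<close> by linarith
    then show ?thesis
    proof cases
      case 1 then show ?thesis using f_width[of "t *\<^sub>R v"] that by (simp add: f_scale)
    next
      case 2 then show ?thesis using f_width[of "s *\<^sub>R u"] that by (simp add: f_scale)
    next
      case 3
      then have "cross2 (s *\<^sub>R u) (t *\<^sub>R v) \<noteq> 0"
        using that by (simp add: cross2_def algebra_simps)
      from f3[OF this] that show ?thesis by (simp add: f_scale)
    qed
  qed
  have triple: "\<exists>z. z \<in> G u \<and> z \<in> G v \<and> z \<in> G w" if uv: "cross2 u v \<noteq> 0" for u v w
  proof -
    obtain s t where w: "w = s *\<^sub>R u + t *\<^sub>R v"
      using frame_coframe[OF uv, of w] unfolding frame_def by metis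
    obtain z where z: "z \<bullet> u = f u" "z \<bullet> v = f v" using solve_inner[OF uv] by metis
    \<comment> \<open>Moving along \<open>d\<close> or \<open>e\<close> preserves the first two
      constraints. If \<open>w\<close> has a positive coordinate, moving far enough in one of these
      directions satisfies the third.\<close>
    obtain d where d: "d \<bullet> u = -1" "d \<bullet> v = 0" using solve_inner[OF uv] by metis
    obtain e where e: "e \<bullet> u = 0" "e \<bullet> v = -1" using solve_inner[OF uv] by metis
    consider "0 < s" | "0 < t" | "s \<le> 0" "t \<le> 0" by linarith
    then show ?thesis
    proof cases
      case 1
      define k where "k = \<bar>z \<bullet> w - f w\<bar> / s"
      have "(z + k *\<^sub>R d) \<bullet> w = z \<bullet> w - k * s"
        by (simp add: w inner_add_left inner_add_right d algebra_simps)
      also have "\<dots> \<le> f w" using 1 by (simp add: k_def)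
      finally have "z + k *\<^sub>R d \<in> G w" by (simp add: G_def)
      moreover have "0 \<le> k" using 1 by (simp add: k_def)
      ultimately show ?thesis using z d
        by (intro exI[of _ "z + k *\<^sub>R d"]) (simp add: G_def inner_add_left)
    next
      case 2
      define k where "k = \<bar>z \<bullet> w - f w\<bar> / t"
      have "(z + k *\<^sub>R e) \<bullet> w = z \<bullet> w - k * t"
        by (simp add: w inner_add_left inner_add_right e algebra_simps)
      also have "\<dots> \<le> f w" using 2 by (simp add: k_def)
      finally have "z + k *\<^sub>R e \<in> G w" by (simp add: G_def)
      moreover have "0 \<le> k" using 2 by (simp add: k_def)
      ultimately show ?thesis using z e
        by (intro exI[of _ "z + k *\<^sub>R e"]) (simp add: G_def inner_add_left)
    next
      case 3
      have "z \<bullet> w \<le> f w" using f_comb[OF uv, of "- s" "- t"] 3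
        by (simp add: w inner_add_right z)
      then show ?thesis using z by (intro exI[of _ z]) (simp add: G_def)
    qed
  qed
  \<comment> \<open>It remains to treat parallel unit normals, which are \<open>u\<close> and
    \<open>- u\<close> only; two opposite half-planes meet by the width inequality.\<close>
  have triple': "\<exists>z. z \<in> G u \<and> z \<in> G v \<and> z \<in> G w" if norm: "norm u = 1" "norm v = 1" "norm w = 1" for u v w
  proof (cases "cross2 u v \<noteq> 0 \<or> cross2 u w \<noteq> 0")
    case True
    then show ?thesis using triple[of u v w] triple[of u w v] by blast
  next
    case False
    have "v = u \<or> v = - u" if "norm v = 1" "cross2 u v = 0" for v
    proof -
      have "\<bar>u \<bullet> v\<bar> = norm u * norm v"
      proof -
        have "(u \<bullet> v)\<^sup>2 + (cross2 u v)\<^sup>2 = (u \<bullet> u) * (v \<bullet> v)"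
          by (simp add: inner_2 cross2_def power2_eq_square algebra_simps)
        then have "(u \<bullet> v)\<^sup>2 = 1" using that norm by (simp add: dot_square_norm)
        then show ?thesis using that norm by (auto simp: power2_eq_1_iff)
      qed
      then have "norm u *\<^sub>R v = norm v *\<^sub>R u \<or> norm u *\<^sub>R v = - norm v *\<^sub>R u"
        unfolding norm_cauchy_schwarz_abs_eq .
      then show ?thesis using that norm by simp
    qed
    with False norm have vw: "v = u \<or> v = - u" "w = u \<or> w = - u" by auto
    have "cross2 u (rot u) = - (u \<bullet> u)" by (simp add: cross2_def rot_def inner_2)
    then have "cross2 u (rot u) \<noteq> 0" using norm by auto
    then obtain z where "z \<in> G u" "z \<in> G (- u)" using triple by blast
    with vw have "z \<in> G u \<and> z \<in> G v \<and> z \<in> G w" by auto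
    then show ?thesis ..
  qed
  have finite: "\<Inter>\<F> \<noteq> {}" if fin: "finite \<F>" and sub: "\<F> \<subseteq> G ` {u. norm u = 1}" for \<F>
  proof -
    have small: "\<Inter>t \<noteq> {}" if t: "t \<subseteq> \<F>" "card t \<le> 3" for t
    proof -
      have ft: "finite t" using fin t finite_subset by blast
      have e: "G (vec2 1 0) \<in> G ` {u. norm u = 1}" by (auto simp: norm_eq_1 inner_2)
      have t': "t \<subseteq> G ` {u. norm u = 1}" using t sub by blast
      consider "card t = 0" | "card t = 1" | "card t = 2" | "card t = 3" using t by linarith
      then have "\<exists>A B D. t \<subseteq> {A, B, D} \<and> {A, B, D} \<subseteq> G ` {u. norm u = 1}"
      proof cases
        case 1
        then have "t = {}" using ft by simp
        then show ?thesis using e by (intro exI[of _ "G (vec2 1 0)"]) simp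
      next
        case 2
        then obtain A where "t = {A}" by (rule card_1_singletonE)
        then show ?thesis using t' by (intro exI[of _ A]) simp
      next
        case 3
        then obtain A B where "t = {A, B}" unfolding card_2_iff by blast
        then show ?thesis using t' by (intro exI[of _ A] exI[of _ B]) simp
      next
        case 4
        then obtain A B D where "t = {A, B, D}" unfolding card_3_iff by blast
        then show ?thesis using t' by (intro exI[of _ A] exI[of _ B] exI[of _ D]) simp
      qed
      then obtain u v w where "t \<subseteq> {G u, G v, G w}" "norm u = 1" "norm v = 1" "norm w = 1" by auto
      moreover obtain z where "z \<in> G u" "z \<in> G v" "z \<in> G w"
        using triple' calculation(2-4) by blast
      ultimately have "z \<in> \<Inter>t" by blast
      then show ?thesis by blast
    qed
    show ?thesis
    proof (cases "card \<F> \<le> 3")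
      case True then show ?thesis using small by blast
    next
      case False
      show ?thesis
      proof (rule Helly)
        show "DIM(real^2) + 1 \<le> card \<F>" using False by simp
        show "\<forall>S\<in>\<F>. convex S" using sub G_convex by blast
        show "\<Inter>t \<noteq> {}" if "t \<subseteq> \<F>" "card t = DIM(real^2) + 1" for t
          using that by (intro small) auto
      qed
    qed
  qed
  \<comment> \<open>Helly's theorem reaches finite families only. These four half-planes cut out a
    compact box, which provides the passage to all directions.\<close>
  define \<B> where "\<B> = G ` {vec2 1 0, vec2 0 1, vec2 (-1) 0, vec2 0 (-1)}"
  have \<B>: "finite \<B>" "\<B> \<subseteq> G ` {u. norm u = 1}"
    by (auto simp: \<B>_def norm_eq_1 inner_2)
  have "\<Inter>\<B> = cbox (vec2 (- f (vec2 (-1) 0)) (- f (vec2 0 (-1)))) (vec2 (f (vec2 1 0)) (f (vec2 0 1)))"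
    by (auto simp: \<B>_def G_def mem_box_cart forall_2 inner_2)
  then have "compact (\<Inter>\<B>)" by simp
  then have "\<Inter>\<B> \<inter> \<Inter>(G ` {u. norm u = 1}) \<noteq> {}"
  proof (rule compact_imp_fip)
    show "closed T" if "T \<in> G ` {u. norm u = 1}" for T
      using that G_closed by blast
    show "\<Inter>\<B> \<inter> \<Inter>\<F> \<noteq> {}" if "finite \<F>" "\<F> \<subseteq> G ` {u. norm u = 1}" for \<F>
      unfolding Inter_Un_distrib[symmetric] by (rule finite) (use \<B> that in auto)
  qed
  then obtain z where z: "\<And>u. norm u = 1 \<Longrightarrow> z \<bullet> u \<le> f u" by (auto simp: G_def)
  have "z \<bullet> u \<le> f u" for u
  proof (cases "u = 0")
    case True then show ?thesis using M C by (simp add: f_def supp_0)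
  next
    case False
    have "z \<bullet> u = norm u * (z \<bullet> ((1 / norm u) *\<^sub>R u))" using False by simp
    also have "\<dots> \<le> norm u * f ((1 / norm u) *\<^sub>R u)"
      using False by (intro mult_left_mono z) auto
    also have "\<dots> = f u" using False by (simp add: f_scale)
    finally show ?thesis .
  qed
  then have "z \<bullet> u + supp M u \<le> supp C u" for u unfolding f_def le_diff_eq .
  then show ?thesis by blast
qed

theorem mixed_area_pluecker:
  assumes K: "K \<in> K2" and L: "L \<in> K2" and M: "M \<in> K2" and N: "N \<in> K2"
  shows "mixed_area K L * mixed_area M N
    \<le> mixed_area K M * mixed_area L N + mixed_area K N * mixed_area L M"
proof -
  define A where "A = (*\<^sub>R) (mixed_area K L) ` M"
  define C where "C = minkowski_sum ((*\<^sub>R) (mixed_area M L) ` K) ((*\<^sub>R) (mixed_area M K) ` L)"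
  note nn = mixed_area_nonneg[OF K L] mixed_area_nonneg[OF M L] mixed_area_nonneg[OF M K]
  have AC: "A \<in> K2" "C \<in> K2" unfolding A_def C_def by (intro scale_K2 minkowski_sum_K2 K L M)+
  have suppA: "supp A u = mixed_area K L * supp M u" for u
    using nn by (simp add: A_def supp_scale_image M)
  have suppC: "supp C u = mixed_area M L * supp K u + mixed_area M K * supp L u" for u
    using nn by (simp add: C_def supp_minkowski_sum scale_K2 supp_scale_image K L)
  have "supp3 A u v \<le> supp3 C u v" if "cross2 u v \<noteq> 0" for u v
    using mixed_area_supp3_inequality[OF M K L that] by (simp add: supp3_def suppA suppC algebra_simps)
  from translate_subset_if_supp3_le[OF AC this]
  obtain z where "\<And>u. z \<bullet> u + supp A u \<le> supp C u" by blast
  then have "mixed_area A N \<le> mixed_area C N" using AC N by (intro mixed_area_le_if_supp)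
  moreover have "mixed_area A N = mixed_area K L * mixed_area M N"
    using nn by (simp add: A_def mixed_area_scale M N)
  moreover have "mixed_area C N = mixed_area M L * mixed_area K N + mixed_area M K * mixed_area L N"
    using nn by (simp add: C_def mixed_area_add mixed_area_scale scale_K2 K L N)
  ultimately show ?thesis by (simp add: mixed_area_commute[of M] algebra_simps)
qed

section \<open>The inclusion and its properness\<close>

lemma PMV2_subset_Pl: "PMV2 n \<subseteq> Pl n"
proof
  fix v assume "v \<in> PMV2 n"
  then obtain K where K: "\<And>i. i \<in> {1..n} \<Longrightarrow> K i \<in> K2"
    and v: "v = (\<lambda>S. if S \<in> pairs n then mixed_area (K (Min S)) (K (Max S)) else 0)"
    unfolding PMV2_def by blast
  have v_pair: "v {i, j} = mixed_area (K i) (K j)" if "i \<in> {1..n}" "j \<in> {1..n}" "i \<noteq> j" for i j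
    using that mixed_area_commute[of "K i"] by (auto simp: v pairs_def min_def max_def)
  have "0 \<le> v S" if "S \<in> pairs n" for S
  proof -
    have "S \<subseteq> {1..n}" "card S = 2" using that by (auto simp: pairs_def)
    then obtain i j where "S = {i, j}" "i \<noteq> j" by (meson card_2_iff)
    moreover from this have "i \<in> {1..n}" "j \<in> {1..n}" using \<open>S \<subseteq> {1..n}\<close> by blast+
    ultimately show ?thesis using v_pair[of i j] mixed_area_nonneg[OF K K, of i j] by simp
  qed
  moreover have "v {i, j} * v {k, l} \<le> v {i, k} * v {j, l} + v {i, l} * v {j, k}"
    if "i \<in> {1..n}" "j \<in> {1..n}" "k \<in> {1..n}" "l \<in> {1..n}" "distinct [i, j, k, l]" for i j k l
    using that mixed_area_pluecker[OF K[of i] K[of j] K[of k] K[of l]] by (simp add: v_pair)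
  moreover have "v S = 0" if "S \<notin> pairs n" for S using that by (simp add: v)
  ultimately show "v \<in> Pl n" unfolding Pl_def by blast
qed

lemma Pl_not_subset_PMV2:
  assumes n: "8 \<le> n"
  shows "\<not> Pl n \<subseteq> PMV2 n"
proof
  assume sub: "Pl n \<subseteq> PMV2 n"
  define v :: "nat set \<Rightarrow> real" where
    "v S = (if S \<in> pairs 8 then if S \<subseteq> {1..4} \<or> S \<subseteq> {5..8} then 7/5 else 1 else 0)" for S
  have v_pair: "v {i, j} = (if i \<in> {1..8} \<and> j \<in> {1..8} then if (i \<le> 4) = (j \<le> 4) then 7/5 else 1 else 0)"
    if "i \<noteq> j" for i j :: nat
    using that by (auto simp: v_def pairs_def)
  have "v \<in> Pl n"
    unfolding Pl_def
  proof (intro CollectI conjI allI ballI impI)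
    fix S assume "S \<notin> pairs n"
    then show "v S = 0" using n by (auto simp: v_def pairs_def)
  next
    fix S show "0 \<le> v S" by (simp add: v_def)
  next
    fix i j k l :: nat assume dist: "distinct [i, j, k, l]"
    \<comment> \<open>The tight case has one pair in each block:
      \<open>49/25 \<le> 1 + 1\<close>.\<close>
    have two_sided: "(if p = q then 7/5 else 1) * (if r = s then 7/5 else 1)
        \<le> (if p = r then 7/5 else 1) * (if q = s then 7/5 else 1)
          + (if p = s then 7/5 else 1) * (if q = r then 7/5 else (1::real))" for p q r s :: bool
      by (cases p; cases q; cases r; cases s) simp_all
    show "v {i, j} * v {k, l} \<le> v {i, k} * v {j, l} + v {i, l} * v {j, k}"
    proof (cases "i \<in> {1..8} \<and> j \<in> {1..8} \<and> k \<in> {1..8} \<and> l \<in> {1..8}")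
      case True
      then have pair: "v {x, y} = (if (x \<le> 4) = (y \<le> 4) then 7/5 else 1)"
        if "x \<in> {i, j, k, l}" "y \<in> {i, j, k, l}" "x \<noteq> y" for x y
        using v_pair[OF that(3)] that(1,2) by auto
      have "v {i, j} = (if (i \<le> 4) = (j \<le> 4) then 7/5 else 1)"
        "v {k, l} = (if (k \<le> 4) = (l \<le> 4) then 7/5 else 1)"
        "v {i, k} = (if (i \<le> 4) = (k \<le> 4) then 7/5 else 1)"
        "v {j, l} = (if (j \<le> 4) = (l \<le> 4) then 7/5 else 1)"
        "v {i, l} = (if (i \<le> 4) = (l \<le> 4) then 7/5 else 1)"
        "v {j, k} = (if (j \<le> 4) = (k \<le> 4) then 7/5 else 1)"
        by (rule pair; use dist in simp)+
      then show ?thesis by (simp only: two_sided)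
    next
      case False
      \<comment> \<open>Every index occurs in one factor on the left, so an index outside the two
        blocks makes the left side vanish.\<close>
      then have "v {i, j} = 0 \<or> v {k, l} = 0" using dist by (auto simp: v_pair)
      moreover have "0 \<le> v S" for S by (simp add: v_def)
      ultimately show ?thesis by auto
    qed
  qed
  with sub obtain K where K: "\<And>i. i \<in> {1..n} \<Longrightarrow> K i \<in> K2"
    and v: "v = (\<lambda>S. if S \<in> pairs n then mixed_area (K (Min S)) (K (Max S)) else 0)"
    unfolding PMV2_def by blast
  show False
  proof (rule two_blocks_not_realizable)
    show "K i \<in> K2" if "i \<in> {1..8}" for i using K that n by auto
    fix i j :: nat assume ij: "i \<in> {1..8}" "j \<in> {1..8}" "i \<noteq> j"
    have "v {i, j} = mixed_area (K i) (K j)"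
      using ij n mixed_area_commute[of "K i"] by (auto simp: v pairs_def min_def max_def)
    then show "mixed_area (K i) (K j) = (if (i \<le> 4) = (j \<le> 4) then 7/5 else 1)"
      using v_pair[of i j] ij by simp
  qed
qed

theorem mainTheorem4:
  shows "(\<forall>n::nat. n \<ge> 4 \<longrightarrow> PMV2 n \<subseteq> Pl n) \<and> (\<forall>n::nat. n \<ge> 8 \<longrightarrow> PMV2 n \<subset> Pl n)"
  using PMV2_subset_Pl Pl_not_subset_PMV2 by blast

end
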